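(* Let $\nu>-1$. Then for every integer $n\ge1$, $$\sum_{k \ge 1} \frac{\big[(j_k^{\nu+1})'\big]^2}{\Big[ \big[(j_k^{\nu+1})'\big]^2 - (\nu+1)^2\Big] \Big[ \big(j_n^{\nu}\big)^2 - \big[(j_k^{\nu+1})' \big]^2\Big]^2} = \frac{1}{4(\nu+1)^2}.$$
   Context: For $\mu>-1$, $\{j_n^{\mu}: n\ge1\}$ denotes the sequence of strictly positive zeros, in ascending order, of the Bessel function of the first kind $J_\mu$, and $\{(j_n^{\mu})': n\ge1\}$ denotes the sequence of strictly positive zeros, in ascending order, of the derivative $J_\mu'$; the prime in $(j_n^\mu)'$ is only notation. *)

theory Defs
  imports "HOL-Analysis.Analysis"
begin

text \<open>The real powers restrict this to \<open>x > 0\<close>; nothing below uses other arguments.\<close>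

definition bessel_J :: "real \<Rightarrow> real \<Rightarrow> real" where
  "bessel_J \<mu> x =
     (\<Sum>m. (- 1) ^ m / (fact m * Gamma (real m + \<mu> + 1)) * (x / 2) powr (2 * real m + \<mu>))"

text \<open>
  The \<open>n\<close>-th element, counted from \<open>1\<close>, of the strictly positive zeros of \<open>f\<close> in ascending
  order. Since infinite sets have cardinality \<open>0\<close>, for \<open>n \<ge> 1\<close> the condition also says that
  only finitely many positive zeros are \<open>\<le> x\<close>.
\<close>

definition pos_zero :: "(real \<Rightarrow> real) \<Rightarrow> nat \<Rightarrow> real" where
  "pos_zero f n = (THE x. 0 < x \<and> f x = 0 \<and> card {y. 0 < y \<and> y \<le> x \<and> f y = 0} = n)"

lemma pos_zero_eqI:
  assumes mono: "strict_mono_on {1..} s"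
    and range: "s ` {1..} = {x. 0 < x \<and> f x = 0}"
    and n: "n \<ge> 1"
  shows "pos_zero f n = s n"
proof -
  have *: "card {y. 0 < y \<and> y \<le> s k \<and> f y = 0} = k" if k: "k \<ge> 1" for k
  proof -
    have "{y. 0 < y \<and> y \<le> s k \<and> f y = 0} = {y \<in> s ` {1..}. y \<le> s k}"
      unfolding range by auto
    also have "\<dots> = s ` {1..k}"
      using k strict_mono_on_less_eq[OF mono] by auto
    finally show ?thesis
      using card_image[OF inj_on_subset[OF strict_mono_on_imp_inj_on[OF mono]], of "{1..k}"]
      by auto
  qed
  show ?thesis
    unfolding pos_zero_def
  proof (rule the_equality)
    show "0 < s n \<and> f (s n) = 0 \<and> card {y. 0 < y \<and> y \<le> s n \<and> f y = 0} = n"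
      using range n *[OF n] by blast
  next
    fix x assume x: "0 < x \<and> f x = 0 \<and> card {y. 0 < y \<and> y \<le> x \<and> f y = 0} = n"
    then obtain k where "k \<ge> 1" "x = s k" using range by (metis (mono_tags, lifting) atLeast_iff imageE mem_Collect_eq)
    with x * show "x = s n" by auto
  qed
qed

definition bessel_zero :: "real \<Rightarrow> nat \<Rightarrow> real" where
  "bessel_zero \<mu> = pos_zero (bessel_J \<mu>)"

definition bessel_deriv_zero :: "real \<Rightarrow> nat \<Rightarrow> real" where
  "bessel_deriv_zero \<mu> = pos_zero (deriv (bessel_J \<mu>))"

end

theory Submission
  imports Defs "HOL-Complex_Analysis.Complex_Analysis"
begin

text \<open>
  Write \<open>\<mu> = \<nu> + 1 > 0\<close>. The sum is a derivative of a partial fraction expansion. With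
  \<open>J\<^sub>\<mu> x = (x/2)\<^sup>\<mu> f (x\<^sup>2)\<close> and \<open>x J\<^sub>\<mu>' x = (x/2)\<^sup>\<mu> g (x\<^sup>2)\<close>, the functions
  \<open>f\<close> = \<open>bessel_f \<mu>\<close> and \<open>g\<close> = \<open>bessel_g \<mu>\<close> are entire in \<open>z = x\<^sup>2\<close>, and Bessel's equation becomes
  the first-order system \<open>2 z f' = g - \<mu> f\<close>, \<open>2 z g' = (\<mu>\<^sup>2 - z) f - \<mu> g\<close>. All zeros of \<open>g\<close> are
  real, simple and larger than \<open>\<mu>\<^sup>2\<close>, and \<open>f / g\<close> has the partial fraction expansion
  \<open>f z / g z = const + (\<Sum>a. r\<^sub>a / (a - z))\<close> with \<open>r\<^sub>a = 2 a / (a - \<mu>\<^sup>2)\<close>. At \<open>x = j\<^sup>2\<close>, where \<open>j\<close>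
  is a positive zero of \<open>J\<^sub>\<nu>\<close>, one has \<open>g x = - \<mu> f x\<close>, because \<open>2 J\<^sub>\<nu>\<close> is \<open>g + \<mu> f\<close> up to a power
  of the variable;
  the system then gives \<open>(f/g)' x = 1 / (2 \<mu>\<^sup>2)\<close>. Differentiating the expansion at \<open>x\<close> gives twice
  the asserted identity.

  The expansion comes from positivity. Subtract from \<open>f / g\<close> the
  principal parts at the finite set \<open>A\<close> of zeros of \<open>g\<close> in the disc of radius \<open>r\<close>. The
  remainder \<open>H\<close> is analytic in that disc (\<open>pole_cancellation\<close>), and off the real line the imaginary
  part of \<open>z H z\<close> never has the sign opposite to \<open>Im z\<close> (\<open>herglotz_remainder\<close>):
  for \<open>f / g\<close> alone, \<open>Im (z f / g) / Im z\<close> is, up to the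
  factor \<open>\<bar>g\<bar>\<^sup>2\<close>, the Dirichlet energy \<open>\<integral> (\<bar>t u'\<bar>\<^sup>2 + \<mu>\<^sup>2 \<bar>u\<bar>\<^sup>2) dt / t\<close> over \<open>[0,1]\<close> of
  \<open>u t = t\<^sup>\<mu> f (z t\<^sup>2)\<close>; the zeros of \<open>g\<close> are the Neumann eigenvalues, their eigenfunctions are
  orthogonal for this energy, and Bessel's inequality for them is precisely positivity after the
  subtraction. On the circle \<open>\<bar>z\<bar> = r\<close> positivity of \<open>Im z * Im (z * H z)\<close> says that
  \<open>(r\<^sup>2 - z\<^sup>2) H z\<close> has nonnegative real part, so this holds in the disc, and the Schwarz lemma
  makes \<open>H\<close> almost constant on a fixed compact set, with error \<open>O(1/r)\<close>, since
  \<open>0 \<le> H 0 \<le> 1 / \<mu>\<close> (\<open>typically_real_nearly_constant\<close>). By Cauchy's inequality \<open>H' x\<close> is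
  \<open>O(1/r)\<close> as well, which is the convergence of the differentiated expansion
  (\<open>partial_sum_bound\<close>).

  It remains to know that \<open>J\<^sub>\<nu>\<close> and \<open>J\<^sub>\<mu>'\<close> have infinitely many positive zeros, finitely many in each
  bounded interval. A Riccati argument gives unboundedly many zeros of \<open>J\<^sub>\<mu>\<close>
  (\<open>bessel_f_zero_exists\<close>), and Rolle's theorem passes to the two other functions
  (\<open>unbounded_zeros\<close>).
\<close>

section \<open>The entire functions behind a Bessel function and its derivative\<close>

definition bcoef :: "real \<Rightarrow> nat \<Rightarrow> real" where
  "bcoef \<mu> m = (- 1) ^ m / (4 ^ m * fact m * Gamma (real m + \<mu> + 1))"

definition bessel_f :: "real \<Rightarrow> 'a \<Rightarrow> 'a::{real_normed_field,banach}" where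
  "bessel_f \<mu> z = (\<Sum>m. of_real (bcoef \<mu> m) * z ^ m)"

definition bessel_f' :: "real \<Rightarrow> 'a \<Rightarrow> 'a::{real_normed_field,banach}" where
  "bessel_f' \<mu> z = (\<Sum>m. of_real (diffs (bcoef \<mu>) m) * z ^ m)"

text \<open>
  If \<open>z = x\<^sup>2\<close>, the operator \<open>2 z (d/dz) + \<mu>\<close> is \<open>x (d/dx)\<close> acting on \<open>x\<^sup>\<mu> f (x\<^sup>2)\<close>, so \<open>bessel_g\<close>
  stands for \<open>x J\<^sub>\<mu>' x\<close>.
\<close>
definition bessel_g :: "real \<Rightarrow> 'a \<Rightarrow> 'a::{real_normed_field,banach}" where
  "bessel_g \<mu> z = 2 * z * bessel_f' \<mu> z + of_real \<mu> * bessel_f \<mu> z"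

text \<open>
  Bessel's differential equation on the level of coefficients.
\<close>
lemma bcoef_Suc:
  assumes "\<mu> > 0"
  shows "4 * real (Suc m) * (real (Suc m) + \<mu>) * bcoef \<mu> (Suc m) = - bcoef \<mu> m"
proof -
  have "Gamma (real (Suc m) + \<mu> + 1) = (real (Suc m) + \<mu>) * Gamma (real m + \<mu> + 1)"
    using Gamma_plus1[of "real (Suc m) + \<mu>"] assms
    by (simp add: add_ac nonpos_Ints_def)
  moreover have "Gamma (real m + \<mu> + 1) > 0"
    using assms by (intro Gamma_real_pos) auto
  ultimately show ?thesis
    using assms unfolding bcoef_def fact_Suc by (simp add: divide_simps)
qed

lemma bcoef_0: "\<mu> > 0 \<Longrightarrow> bcoef \<mu> 0 > 0"
  by (simp add: bcoef_def)

lemma abs_bcoef_le: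
  assumes "\<mu> > 0"
  shows "\<bar>bcoef \<mu> m\<bar> \<le> bcoef \<mu> 0 / fact m"
proof (induction m)
  case 0
  then show ?case using bcoef_0[OF assms] by simp
next
  case (Suc m)
  have "real (Suc m) * \<bar>bcoef \<mu> (Suc m)\<bar> * 1 \<le> real (Suc m) * \<bar>bcoef \<mu> (Suc m)\<bar> * (4 * (real (Suc m) + \<mu>))"
    using assms by (intro mult_left_mono) auto
  also have "\<dots> = \<bar>4 * real (Suc m) * (real (Suc m) + \<mu>) * bcoef \<mu> (Suc m)\<bar>"
  proof -
    have "\<bar>real (Suc m) + \<mu>\<bar> = real (Suc m) + \<mu>" using assms by simp
    thus ?thesis by (simp only: abs_mult abs_numeral abs_of_nat mult_ac mult_1_right)
  qed
  also have "\<dots> \<le> bcoef \<mu> 0 / fact m"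
    using Suc by (simp only: bcoef_Suc[OF assms] abs_minus_cancel)
  finally have "real (Suc m) * \<bar>bcoef \<mu> (Suc m)\<bar> * fact m \<le> bcoef \<mu> 0"
    by (simp add: pos_le_divide_eq)
  thus ?case
    by (subst pos_le_divide_eq[OF fact_gt_zero]) (simp add: algebra_simps)
qed

lemma summable_bcoef:
  fixes z :: "'a::{real_normed_field,banach}"
  assumes "\<mu> > 0"
  shows "summable (\<lambda>m. of_real (bcoef \<mu> m) * z ^ m)"
proof (rule summable_comparison_test')
  show "summable (\<lambda>m. bcoef \<mu> 0 * (inverse (fact m) * norm z ^ m))"
    by (intro summable_mult summable_exp)
  show "norm (of_real (bcoef \<mu> m) * z ^ m) \<le> bcoef \<mu> 0 * (inverse (fact m) * norm z ^ m)" if "m \<ge> 0" for m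
    using mult_right_mono[OF abs_bcoef_le[OF assms, of m], of "norm z ^ m"]
    by (simp add: norm_mult norm_power divide_inverse mult.assoc)
qed

lemma bessel_f_has_field_derivative:
  fixes z :: "'a::{real_normed_field,banach}"
  assumes "\<mu> > 0"
  shows "(bessel_f \<mu> has_field_derivative bessel_f' \<mu> z) (at z)"
  using termdiffs_strong_converges_everywhere[of "\<lambda>m. of_real (bcoef \<mu> m)" z] summable_bcoef[OF assms]
  unfolding diffs_of_real bessel_f'_def bessel_f_def[abs_def] by blast

lemma summable_diffs_bcoef:
  fixes z :: "'a::{real_normed_field,banach}"
  assumes "\<mu> > 0"
  shows "summable (\<lambda>m. of_real (diffs (bcoef \<mu>) m) * z ^ m)"
  using termdiff_converges_all[of "\<lambda>m. of_real (bcoef \<mu> m)" z] summable_bcoef[OF assms]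
  unfolding diffs_of_real by blast

lemma summable_diffs2_bcoef:
  fixes z :: "'a::{real_normed_field,banach}"
  assumes "\<mu> > 0"
  shows "summable (\<lambda>m. of_real (diffs (diffs (bcoef \<mu>)) m) * z ^ m)"
  using termdiff_converges_all[of "\<lambda>m. of_real (diffs (bcoef \<mu>) m)" z] summable_diffs_bcoef[OF assms]
  unfolding diffs_of_real by blast

lemma bessel_f'_has_field_derivative:
  fixes z :: "'a::{real_normed_field,banach}"
  assumes "\<mu> > 0"
  shows "(bessel_f' \<mu> has_field_derivative (\<Sum>m. of_real (diffs (diffs (bcoef \<mu>)) m) * z ^ m)) (at z)"
  using termdiffs_strong_converges_everywhere[of "\<lambda>m. of_real (diffs (bcoef \<mu>) m)" z]
    summable_diffs_bcoef[OF assms]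
  unfolding diffs_of_real bessel_f'_def[abs_def] by blast

lemma bessel_f_ode:
  fixes z :: "'a::{real_normed_field,banach}"
  assumes "\<mu> > 0"
  shows "4 * z * (\<Sum>m. of_real (diffs (diffs (bcoef \<mu>)) m) * z ^ m)
           + 4 * (of_real \<mu> + 1) * bessel_f' \<mu> z + bessel_f \<mu> z = 0"
proof -
  let ?c = "\<lambda>m. of_real (bcoef \<mu> m) :: 'a"
  let ?d = "\<lambda>m. of_real (diffs (bcoef \<mu>) m) :: 'a"
  let ?e = "\<lambda>m. of_real (diffs (diffs (bcoef \<mu>)) m) :: 'a"
  have "(\<lambda>m. of_nat m * ?d m * z ^ (m - 1)) sums (\<Sum>m. ?e m * z ^ m)"
    using diffs_equiv[of ?d z] summable_diffs2_bcoef[OF assms] unfolding diffs_of_real by auto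
  from sums_mult[OF this, of z]
  have 1: "(\<lambda>m. of_nat m * ?d m * z ^ m) sums (z * (\<Sum>m. ?e m * z ^ m))"
    by (rule back_subst[where P="\<lambda>f. f sums _"])
       (auto simp: fun_eq_iff power_eq_if)
  have 2: "(\<lambda>m. ?d m * z ^ m) sums bessel_f' \<mu> z"
    unfolding bessel_f'_def by (intro summable_sums summable_diffs_bcoef assms)
  have 3: "(\<lambda>m. ?c m * z ^ m) sums bessel_f \<mu> z"
    unfolding bessel_f_def by (intro summable_sums summable_bcoef assms)
  have "(\<lambda>m. 4 * (of_nat m * ?d m * z ^ m) + 4 * (of_real \<mu> + 1) * (?d m * z ^ m) + ?c m * z ^ m)
     sums (4 * (z * (\<Sum>m. ?e m * z ^ m)) + 4 * (of_real \<mu> + 1) * bessel_f' \<mu> z + bessel_f \<mu> z)"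
    by (intro sums_add sums_mult 1 2 3)
  moreover have "4 * (of_nat m * ?d m * z ^ m) + 4 * (of_real \<mu> + 1) * (?d m * z ^ m) + ?c m * z ^ m = 0" for m
  proof -
    have "4 * (real m * diffs (bcoef \<mu>) m) + 4 * (\<mu> + 1) * diffs (bcoef \<mu>) m + bcoef \<mu> m = 0"
      using bcoef_Suc[OF assms, of m] by (simp add: diffs_def algebra_simps)
    hence "of_real (4 * (real m * diffs (bcoef \<mu>) m) + 4 * (\<mu> + 1) * diffs (bcoef \<mu>) m + bcoef \<mu> m) = (0::'a)"
      by simp
    hence "(of_real (4 * (real m * diffs (bcoef \<mu>) m) + 4 * (\<mu> + 1) * diffs (bcoef \<mu>) m + bcoef \<mu> m) :: 'a) * z ^ m = 0"
      by simp
    thus ?thesis by (simp add: algebra_simps)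
  qed
  ultimately show ?thesis
    using sums_unique2[OF sums_zero] by (simp add: mult.assoc)
qed

text \<open>
  Together with \<open>bessel_g_deriv_eq\<close>, this writes Bessel's equation as a first-order system for \<open>f\<close> and \<open>g\<close>.
\<close>
lemma bessel_f_deriv_eq:
  fixes z :: "'a::{real_normed_field,banach}"
  shows "2 * z * bessel_f' \<mu> z = bessel_g \<mu> z - of_real \<mu> * bessel_f \<mu> z"
  by (simp add: bessel_g_def)

definition bessel_g' :: "real \<Rightarrow> 'a \<Rightarrow> 'a::{real_normed_field,banach}" where
  "bessel_g' \<mu> z = 2 * bessel_f' \<mu> z + 2 * z * (\<Sum>m. of_real (diffs (diffs (bcoef \<mu>)) m) * z ^ m)
     + of_real \<mu> * bessel_f' \<mu> z"

lemma bessel_g_has_field_derivative: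
  fixes z :: "'a::{real_normed_field,banach}"
  assumes "\<mu> > 0"
  shows "(bessel_g \<mu> has_field_derivative bessel_g' \<mu> z) (at z)"
  unfolding bessel_g_def[abs_def] bessel_g'_def
  by (rule derivative_eq_intros bessel_f_has_field_derivative[OF assms] bessel_f'_has_field_derivative[OF assms] refl)+ simp

lemma bessel_g_deriv_eq:
  fixes z :: "'a::{real_normed_field,banach}"
  assumes "\<mu> > 0"
  shows "2 * z * bessel_g' \<mu> z = (of_real \<mu> ^ 2 - z) * bessel_f \<mu> z - of_real \<mu> * bessel_g \<mu> z"
proof -
  let ?e = "(\<Sum>m. of_real (diffs (diffs (bcoef \<mu>)) m) * z ^ m)"
  have "z * (4 * z * ?e + 4 * (of_real \<mu> + 1) * bessel_f' \<mu> z + bessel_f \<mu> z) = 0"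
    by (simp only: bessel_f_ode[OF assms] mult_zero_right)
  thus ?thesis unfolding bessel_g_def bessel_g'_def by algebra
qed

lemma bessel_f_of_real:
  assumes "\<mu> > 0"
  shows "bessel_f \<mu> (of_real x) = (of_real (bessel_f \<mu> x) :: 'a::{real_normed_field,banach})"
  unfolding bessel_f_def using suminf_of_real[OF summable_bcoef[OF assms, of x], where 'a='a]
  by simp

lemma bessel_f'_of_real:
  assumes "\<mu> > 0"
  shows "bessel_f' \<mu> (of_real x) = (of_real (bessel_f' \<mu> x) :: 'a::{real_normed_field,banach})"
  unfolding bessel_f'_def using suminf_of_real[OF summable_diffs_bcoef[OF assms, of x], where 'a='a]
  by simp

lemma bessel_g_of_real:
  assumes "\<mu> > 0"
  shows "bessel_g \<mu> (of_real x) = (of_real (bessel_g \<mu> x) :: 'a::{real_normed_field,banach})"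
  unfolding bessel_g_def using assms by (simp add: bessel_f_of_real bessel_f'_of_real)

lemma bessel_f_cnj:
  assumes "\<mu> > 0"
  shows "bessel_f \<mu> (cnj z) = cnj (bessel_f \<mu> z)"
  unfolding bessel_f_def using bounded_linear.suminf[OF bounded_linear_cnj summable_bcoef[OF assms, of z]] by simp

lemma bessel_g_cnj:
  assumes "\<mu> > 0"
  shows "bessel_g \<mu> (cnj z) = cnj (bessel_g \<mu> z)"
proof -
  have "bessel_f' \<mu> (cnj z) = cnj (bessel_f' \<mu> z)"
    unfolding bessel_f'_def using bounded_linear.suminf[OF bounded_linear_cnj summable_diffs_bcoef[OF assms, of z]] by simp
  thus ?thesis by (simp add: bessel_g_def bessel_f_cnj assms)
qed

lemma bessel_f_0: "bessel_f \<mu> 0 = of_real (bcoef \<mu> 0)"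
  unfolding bessel_f_def by (rule powser_zero)

lemma bessel_g_0: "bessel_g \<mu> 0 = of_real (\<mu> * bcoef \<mu> 0)"
  by (simp add: bessel_g_def bessel_f_0)

section \<open>The energy form\<close>

text \<open>
  For \<open>u t = t\<^sup>\<mu> f (z t\<^sup>2)\<close> and \<open>v t = t\<^sup>\<mu> f (w t\<^sup>2)\<close>, this is \<open>((t u') (t v') + \<mu>\<^sup>2 u v) / t\<close>, the density of
  the energy form for which the Bessel operator is symmetric.
\<close>
definition energy_deriv :: "real \<Rightarrow> complex \<Rightarrow> complex \<Rightarrow> real \<Rightarrow> complex" where
  "energy_deriv \<mu> z w t = of_real (t powr (2 * \<mu> - 1)) *
     (bessel_g \<mu> (z * of_real t ^ 2) * bessel_g \<mu> (w * of_real t ^ 2) +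
      of_real (\<mu> ^ 2) * (bessel_f \<mu> (z * of_real t ^ 2) * bessel_f \<mu> (w * of_real t ^ 2)))"

text \<open>
  A primitive in closed form of that density, vanishing at \<open>t = 0\<close>. For \<open>z \<noteq> w\<close> it comes
  from Green's formula; the case \<open>z = w\<close> is its limit. Working with the primitive replaces
  all integrals, which would be improper for \<open>\<mu> < 1/2\<close>, by monotonicity arguments.
\<close>
definition energy :: "real \<Rightarrow> complex \<Rightarrow> complex \<Rightarrow> real \<Rightarrow> complex" where
  "energy \<mu> z w t = of_real (t powr (2 * \<mu>)) *
    (let fz = bessel_f \<mu> (z * of_real t ^ 2); gz = bessel_g \<mu> (z * of_real t ^ 2);
         fw = bessel_f \<mu> (w * of_real t ^ 2); gw = bessel_g \<mu> (w * of_real t ^ 2)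
     in if z = w then fz * gz + (gz ^ 2 + (z * of_real t ^ 2 - of_real \<mu> ^ 2) * fz ^ 2) / 2
        else (z * fz * gw - w * gz * fw) / (z - w))"

text \<open>
  The Euler operator \<open>t (d/dt)\<close> applied to \<open>F (z t\<^sup>2)\<close> is \<open>2 y F' y\<close> at \<open>y = z t\<^sup>2\<close>, the expression
  that the first-order system provides.
\<close>
lemma scaled_deriv:
  assumes "(F has_field_derivative D) (at (z * of_real t ^ 2))" "2 * (z * of_real t ^ 2) * D = E" "t > 0"
  shows "((\<lambda>t. F (z * of_real t ^ 2)) has_vector_derivative E / of_real t) (at t)"
proof -
  have "((\<lambda>t. F (z * t ^ 2)) has_field_derivative D * (2 * z * of_real t)) (at (of_real t))"
    by (rule DERIV_chain2[where g = "\<lambda>t. z * t ^ 2", OF assms(1)])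
       (auto intro!: derivative_eq_intros)
  moreover have "D * (2 * z * of_real t) = E / of_real t"
    using assms(2,3) by (auto simp: field_simps power2_eq_square)
  ultimately have "((\<lambda>t. F (z * t ^ 2)) has_field_derivative E / of_real t) (at (of_real t))" by simp
  from has_vector_derivative_real_field[OF this] show ?thesis by (simp add: o_def)
qed

lemma powr_deriv:
  assumes "t > 0"
  shows "((\<lambda>t. complex_of_real (t powr a)) has_vector_derivative of_real a * of_real (t powr a) / of_real t) (at t)"
proof -
  have "((\<lambda>t. t powr a) has_real_derivative (a * t powr (a - 1))) (at t)"
    by (rule has_real_derivative_powr[OF assms])
  also have "a * t powr (a - 1) = a * t powr a / t" using assms by (simp add: powr_diff)
  finally show ?thesis
    by (auto dest!: has_vector_derivative_of_real[where 'a=complex])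
qed

lemma energy_has_vector_derivative:
  assumes mu: "\<mu> > 0" and t: "t > 0"
  shows "(energy \<mu> z w has_vector_derivative energy_deriv \<mu> z w t) (at t)"
proof -
  define s where "s = complex_of_real t"
  define p where "p = complex_of_real (t powr (2 * \<mu>))"
  have s0: "s \<noteq> 0" using t by (simp add: s_def)
  have p: "complex_of_real (t powr (2 * \<mu> - 1)) = p / s"
    using t by (simp add: p_def s_def powr_diff)
  note f = scaled_deriv[OF bessel_f_has_field_derivative[OF mu] bessel_f_deriv_eq t]
  note g = scaled_deriv[OF bessel_g_has_field_derivative[OF mu] bessel_g_deriv_eq[OF mu] t]
  have id: "((\<lambda>t. complex_of_real t) has_vector_derivative 1) (at t)"
    using has_vector_derivative_of_real[OF DERIV_ident] by simp
  have q: "((\<lambda>t. z * complex_of_real t ^ 2) has_vector_derivative 2 * z * s) (at t)" for z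
    using has_vector_derivative_mult[OF has_vector_derivative_const has_vector_derivative_mult[OF id id], of z]
    by (simp add: power2_eq_square s_def mult_ac)
  define F where "F = (\<lambda>z. bessel_f \<mu> (z * s ^ 2))"
  define G where "G = (\<lambda>z. bessel_g \<mu> (z * s ^ 2))"
  have fold: "complex_of_real t = s" "complex_of_real (t powr (2 * \<mu>)) = p"
    "bessel_f \<mu> (z * s ^ 2) = F z" "bessel_g \<mu> (z * s ^ 2) = G z" for z
    by (simp_all add: s_def p_def F_def G_def)
  have fd: "((\<lambda>t. bessel_f \<mu> (z * of_real t ^ 2)) has_vector_derivative (G z - of_real \<mu> * F z) / s) (at t)" for z
    using f[of z] by (simp add: F_def G_def s_def)
  have gd: "((\<lambda>t. bessel_g \<mu> (z * of_real t ^ 2)) has_vector_derivative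
      ((of_real \<mu> ^ 2 - z * s ^ 2) * F z - of_real \<mu> * G z) / s) (at t)" for z
    using g[of z] by (simp add: F_def G_def s_def)
  have pd: "((\<lambda>t. complex_of_real (t powr (2 * \<mu>))) has_vector_derivative 2 * of_real \<mu> * p / s) (at t)"
    using powr_deriv[OF t, of "2 * \<mu>"] by (simp add: p_def s_def)
  show ?thesis
  proof (cases "z = w")
    case False
    have 1: "((\<lambda>t. of_real (t powr (2 * \<mu>)) * (bessel_f \<mu> (z * of_real t ^ 2) * bessel_g \<mu> (w * of_real t ^ 2)))
      has_vector_derivative p / s * (G z * G w + (of_real \<mu> ^ 2 - w * s ^ 2) * F z * F w)) (at t)" for z w
      by (rule has_vector_derivative_eq_rhs, rule has_vector_derivative_mult[OF pd has_vector_derivative_mult[OF fd gd]])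
         (unfold fold, use s0 in \<open>simp add: field_simps\<close>)
    have cancel: "1 / (z - w) * ((z - w) * X) = X" for X
      using False by simp
    have e: "energy \<mu> z w = (\<lambda>t. (1 / (z - w)) * (
       z * (of_real (t powr (2 * \<mu>)) * (bessel_f \<mu> (z * of_real t ^ 2) * bessel_g \<mu> (w * of_real t ^ 2)))
       - w * (of_real (t powr (2 * \<mu>)) * (bessel_f \<mu> (w * of_real t ^ 2) * bessel_g \<mu> (z * of_real t ^ 2)))))"
      using False by (auto simp: energy_def Let_def fun_eq_iff field_simps)
    have "(energy \<mu> z w has_vector_derivative 1 / (z - w) * (
        z * (p / s * (G z * G w + (of_real \<mu> ^ 2 - w * s ^ 2) * F z * F w))
        - w * (p / s * (G w * G z + (of_real \<mu> ^ 2 - z * s ^ 2) * F w * F z)))) (at t)"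
      unfolding e by (intro has_vector_derivative_mult_right has_vector_derivative_diff 1)
    also have "z * (p / s * (G z * G w + (of_real \<mu> ^ 2 - w * s ^ 2) * F z * F w))
        - w * (p / s * (G w * G z + (of_real \<mu> ^ 2 - z * s ^ 2) * F w * F z)) =
        (z - w) * (p / s * (G z * G w + of_real \<mu> ^ 2 * (F z * F w)))"
      using s0 by (simp add: field_simps)
    also have "1 / (z - w) * \<dots> = energy_deriv \<mu> z w t"
      using False by (simp only: cancel energy_deriv_def p fold of_real_power)
    finally show ?thesis .
  next
    case True
    have e: "energy \<mu> z w = (\<lambda>t. of_real (t powr (2 * \<mu>)) *
       (bessel_f \<mu> (z * of_real t ^ 2) * bessel_g \<mu> (z * of_real t ^ 2) +
        1 / 2 * (bessel_g \<mu> (z * of_real t ^ 2) * bessel_g \<mu> (z * of_real t ^ 2)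
          + (z * of_real t ^ 2 - of_real \<mu> ^ 2) * (bessel_f \<mu> (z * of_real t ^ 2) * bessel_f \<mu> (z * of_real t ^ 2)))))"
      using True by (auto simp: energy_def Let_def fun_eq_iff power2_eq_square)
    note q' = has_vector_derivative_diff[OF q has_vector_derivative_const]
    show ?thesis unfolding e
      by (rule has_vector_derivative_eq_rhs,
          rule has_vector_derivative_mult[OF pd has_vector_derivative_add[OF has_vector_derivative_mult[OF fd gd]
             has_vector_derivative_mult_right[OF has_vector_derivative_add[OF has_vector_derivative_mult[OF gd gd]
               has_vector_derivative_mult[OF q' has_vector_derivative_mult[OF fd fd]]]]]])
         (unfold energy_deriv_def p True[symmetric] fold, use s0 in \<open>simp add: field_simps power2_eq_square\<close>)
  qed
qed

lemma continuous_on_bessel_scaled: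
  assumes "\<mu> > 0"
  shows "continuous_on S (\<lambda>t. bessel_f \<mu> (z * complex_of_real t ^ 2))"
    and "continuous_on S (\<lambda>t. bessel_g \<mu> (z * complex_of_real t ^ 2))"
proof -
  have "continuous_on UNIV (bessel_f \<mu> :: complex \<Rightarrow> _)" "continuous_on UNIV (bessel_g \<mu> :: complex \<Rightarrow> _)"
    using bessel_f_has_field_derivative[OF assms] bessel_g_has_field_derivative[OF assms]
    by (auto intro!: continuous_at_imp_continuous_on DERIV_isCont)
  note * = continuous_on_compose2[OF this(1)] continuous_on_compose2[OF this(2)]
  show "continuous_on S (\<lambda>t. bessel_f \<mu> (z * complex_of_real t ^ 2))"
    by (rule *(1)) (auto intro!: continuous_intros)
  show "continuous_on S (\<lambda>t. bessel_g \<mu> (z * complex_of_real t ^ 2))"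
    by (rule *(2)) (auto intro!: continuous_intros)
qed

lemma continuous_on_energy:
  assumes "\<mu> > 0"
  shows "continuous_on {0..} (energy \<mu> z w)"
proof -
  have "continuous_on {0..} (\<lambda>t::real. t powr (2 * \<mu>))"
    using assms by (intro continuous_on_powr' continuous_intros) auto
  hence "continuous_on {0..} (\<lambda>t::real. complex_of_real (t powr (2 * \<mu>)))"
    by (rule continuous_on_of_real)
  thus ?thesis unfolding energy_def Let_def using assms
    by (cases "z = w") (auto intro!: continuous_intros continuous_on_bessel_scaled)
qed

lemma energy_0: "energy \<mu> z w 0 = 0"
  by (simp add: energy_def)

lemma Re_energy_deriv_cnj:
  assumes "\<mu> > 0"
  shows "Re (energy_deriv \<mu> z (cnj z) t) = t powr (2 * \<mu> - 1) *
     (norm (bessel_g \<mu> (z * of_real t ^ 2)) ^ 2 + \<mu> ^ 2 * norm (bessel_f \<mu> (z * of_real t ^ 2)) ^ 2)"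
proof -
  have *: "cnj z * of_real t ^ 2 = cnj (z * of_real t ^ 2)" by simp
  have "energy_deriv \<mu> z (cnj z) t = of_real (t powr (2 * \<mu> - 1) *
     (norm (bessel_g \<mu> (z * of_real t ^ 2)) ^ 2 + \<mu> ^ 2 * norm (bessel_f \<mu> (z * of_real t ^ 2)) ^ 2))"
    by (simp only: energy_deriv_def * of_real_mult of_real_add bessel_f_cnj[OF assms]
        bessel_g_cnj[OF assms] complex_norm_square)
  thus ?thesis by simp
qed

text \<open>
  The energy of \<open>t\<^sup>\<mu> f (z t\<^sup>2)\<close> is strictly positive because \<open>f 0 \<noteq> 0\<close> makes the density positive
  for small \<open>t\<close>. Evaluated at a zero of \<open>g\<close>, it shows that the zero is real and larger than \<open>\<mu>\<^sup>2\<close>.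
\<close>
lemma energy_cnj_pos:
  assumes mu: "\<mu> > 0"
  shows "Re (energy \<mu> z (cnj z) 1) > 0"
proof -
  define P where "P = (\<lambda>t. Re (energy \<mu> z (cnj z) t))"
  have contP: "continuous_on {a..b} P" if "a \<ge> 0" for a b
    unfolding P_def using that
    by (intro continuous_intros continuous_on_subset[OF continuous_on_energy[OF mu]]) auto
  have derP: "(P has_real_derivative t powr (2 * \<mu> - 1) *
     (norm (bessel_g \<mu> (z * of_real t ^ 2)) ^ 2 + \<mu> ^ 2 * norm (bessel_f \<mu> (z * of_real t ^ 2)) ^ 2)) (at t)"
    if "t > 0" for t
    using bounded_linear.has_vector_derivative[OF bounded_linear_Re energy_has_vector_derivative[OF mu that, of z "cnj z"]]
    unfolding Re_energy_deriv_cnj[OF mu] P_def has_real_derivative_iff_has_vector_derivative .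
  have "isCont (\<lambda>t. bessel_f \<mu> (z * complex_of_real t ^ 2)) 0"
    using continuous_on_bessel_scaled(1)[OF mu, of UNIV z] by (simp add: continuous_on_eq_continuous_at)
  moreover have "bessel_f \<mu> (z * complex_of_real 0 ^ 2) \<noteq> 0"
    using bcoef_0[OF mu] by (simp add: bessel_f_0)
  ultimately obtain d where d: "d > 0" "\<And>t. \<bar>t\<bar> < d \<Longrightarrow> bessel_f \<mu> (z * complex_of_real t ^ 2) \<noteq> 0"
    using continuous_at_avoid[of 0 "\<lambda>t. bessel_f \<mu> (z * complex_of_real t ^ 2)" 0] by (auto simp: dist_norm)
  define e where "e = min d 1"
  have e: "0 < e" "e \<le> d" "e \<le> 1" using d by (auto simp: e_def)
  have "P 0 < P e"
  proof (rule DERIV_pos_imp_increasing_open[where f = P])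
    fix t assume t: "0 < t" "t < e"
    have "t powr (2 * \<mu> - 1) *
     (norm (bessel_g \<mu> (z * of_real t ^ 2)) ^ 2 + \<mu> ^ 2 * norm (bessel_f \<mu> (z * of_real t ^ 2)) ^ 2) > 0"
      using t mu d(2)[of t] e by (intro mult_pos_pos add_nonneg_pos) auto
    with derP[OF t(1)] show "\<exists>y. (P has_real_derivative y) (at t) \<and> 0 < y" by blast
  qed (use e contP[of 0 e] in auto)
  also have "P e \<le> P 1"
  proof (rule DERIV_nonneg_imp_increasing_open[where f = P])
    fix t :: real assume t: "e < t" "t < 1"
    hence "t > 0" using e by auto
    have "t powr (2 * \<mu> - 1) *
     (norm (bessel_g \<mu> (z * of_real t ^ 2)) ^ 2 + \<mu> ^ 2 * norm (bessel_f \<mu> (z * of_real t ^ 2)) ^ 2) \<ge> 0"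
      by simp
    with derP[OF \<open>t > 0\<close>] show "\<exists>y. (P has_real_derivative y) (at t) \<and> 0 \<le> y" by blast
  qed (use e contP[of e 1] in auto)
  finally show ?thesis by (simp add: P_def energy_0)
qed

text \<open>
  Both terms in the off-diagonal formula for the energy at \<open>t = 1\<close> contain a factor \<open>g z\<close> or \<open>g (cnj z)\<close>.
\<close>
lemma bessel_g_zero_imp_real:
  fixes z :: complex
  assumes mu: "\<mu> > 0" and z: "bessel_g \<mu> z = 0"
  shows "z \<in> \<real>"
proof (rule ccontr)
  assume "z \<notin> \<real>"
  hence ne: "z \<noteq> cnj z" by (auto simp: Reals_cnj_iff)
  have "bessel_g \<mu> (cnj z) = 0" by (simp add: bessel_g_cnj[OF mu] z)
  hence "energy \<mu> z (cnj z) 1 = 0"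
    by (simp only: energy_def Let_def ne z if_False power_one of_real_1 mult_1_right) simp
  with energy_cnj_pos[OF mu, of z] show False by simp
qed

lemma energy_diag_zero:
  assumes "\<mu> > 0" "bessel_g \<mu> a = 0"
  shows "energy \<mu> (of_real a) (of_real a) 1 = of_real ((a - \<mu>\<^sup>2) * bessel_f \<mu> a ^ 2 / 2)"
  using assms by (simp add: energy_def Let_def bessel_f_of_real bessel_g_of_real)

lemma bessel_g_zero:
  fixes a :: real
  assumes mu: "\<mu> > 0" and z: "bessel_g \<mu> a = 0"
  shows "a > \<mu>\<^sup>2" "bessel_f \<mu> a \<noteq> 0"
proof -
  have "(a - \<mu>\<^sup>2) * bessel_f \<mu> a ^ 2 / 2 > 0"
    using energy_cnj_pos[OF mu, of "of_real a"] by (simp add: energy_diag_zero[OF mu z])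
  thus "a > \<mu>\<^sup>2" "bessel_f \<mu> a \<noteq> 0"
    by (auto simp: zero_less_mult_iff)
qed

lemma mult_diff_expand: "(x - s) * (y - t) = x * y - x * t - s * y + s * (t :: 'a :: comm_ring)"
  by (simp add: algebra_simps)

text \<open>
  Bessel's inequality for the eigenfunctions \<open>t\<^sup>\<mu> f (a t\<^sup>2)\<close>, which are orthogonal at \<open>t = 1\<close>
  because \<open>g\<close> vanishes at each \<open>a\<close>. It is the statement that the energy of
  \<open>t\<^sup>\<mu> f (z t\<^sup>2)\<close> minus its orthogonal projection is nonnegative.
\<close>
lemma bessel_inequality:
  assumes mu: "\<mu> > 0" and A: "finite A" "\<And>a. a \<in> A \<Longrightarrow> bessel_g \<mu> a = 0" and z: "Im z \<noteq> 0"
  shows "(\<Sum>a\<in>A. norm (energy \<mu> z (of_real a) 1) ^ 2 / Re (energy \<mu> (of_real a) (of_real a) 1))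
           \<le> Re (energy \<mu> z (cnj z) 1)"
proof -
  define N where "N = (\<lambda>a. (a - \<mu>\<^sup>2) * bessel_f \<mu> a ^ 2 / 2)"
  define E where "E = (\<lambda>a. energy \<mu> z (complex_of_real a) 1)"
  have N: "energy \<mu> (of_real a) (of_real a) 1 = of_real (N a)" "N a > 0" if "a \<in> A" for a
    using energy_diag_zero[OF mu A(2)[OF that]] bessel_g_zero[OF mu A(2)[OF that]]
    by (simp_all add: N_def)
  have orth: "energy \<mu> (of_real a) (of_real b) 1 = 0" if "a \<in> A" "b \<in> A" "a \<noteq> b" for a b
    using A(2) that mu by (simp add: energy_def Let_def bessel_g_of_real)
  define c where "c = (\<lambda>a. E a / of_real (N a))"
  \<comment> \<open>the form evaluated on the projection error and its conjugate, expanded by bilinearity\<close>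
  let ?comb = "\<lambda>e. (e z (cnj z) :: complex) - (\<Sum>a\<in>A. cnj (c a) * e z (of_real a))
     - (\<Sum>a\<in>A. c a * e (of_real a) (cnj z)) + (\<Sum>a\<in>A. \<Sum>b\<in>A. c a * cnj (c b) * e (of_real a) (of_real b))"
  define P where "P = (\<lambda>t. Re (?comb (\<lambda>z w. energy \<mu> z w t)))"
  have cnjE: "energy \<mu> (of_real a) (cnj z) 1 = cnj (E a)" for a
  proof -
    have ne: "z \<noteq> of_real a" "of_real a \<noteq> cnj z"
      using z by (auto simp: complex_eq_iff)
    have "cnj (E a) = (cnj z * cnj (bessel_f \<mu> z) * of_real (bessel_g \<mu> a)
        - of_real a * cnj (bessel_g \<mu> z) * of_real (bessel_f \<mu> a)) / (cnj z - of_real a)"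
      using ne(1) mu by (simp add: E_def energy_def Let_def bessel_f_of_real bessel_g_of_real)
    also have "\<dots> = (of_real a * of_real (bessel_f \<mu> a) * cnj (bessel_g \<mu> z)
        - cnj z * of_real (bessel_g \<mu> a) * cnj (bessel_f \<mu> z)) / (of_real a - cnj z)"
      by (subst minus_divide_divide[symmetric]) (simp add: mult_ac)
    also have "\<dots> = energy \<mu> (of_real a) (cnj z) 1"
      using ne(2) mu by (simp add: energy_def Let_def bessel_f_of_real bessel_g_of_real bessel_f_cnj bessel_g_cnj)
    finally show ?thesis ..
  qed
  have "P 0 \<le> P 1"
  proof (rule DERIV_nonneg_imp_increasing_open[where f = P])
    show "continuous_on {0..1} P" unfolding P_def
      by (intro continuous_intros continuous_on_subset[OF continuous_on_energy[OF mu]]) auto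
  next
    fix t :: real assume t: "0 < t" "t < 1"
    define F where "F = (\<lambda>z. bessel_f \<mu> (z * complex_of_real t ^ 2))"
    define G where "G = (\<lambda>z. bessel_g \<mu> (z * complex_of_real t ^ 2))"
    have cnjFG: "F (cnj w) = cnj (F w)" "G (cnj w) = cnj (G w)" for w
      using bessel_f_cnj[OF mu, of "w * of_real t ^ 2"] bessel_g_cnj[OF mu, of "w * of_real t ^ 2"]
      by (auto simp: F_def G_def)
    have realFG: "cnj (F (of_real a)) = F (of_real a)" "cnj (G (of_real a)) = G (of_real a)" for a
      using cnjFG[of "of_real a"] by simp_all
    define S where "S = (\<lambda>F. F z - (\<Sum>a\<in>A. c a * F (complex_of_real a)) :: complex)"
    have S: "?comb (\<lambda>z w. F z * F w) = of_real (norm (S F) ^ 2)"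
      if "F (cnj z) = cnj (F z)" "\<And>a. cnj (F (of_real a)) = F (of_real a)" for F
    proof -
      have "cnj (S F) = F (cnj z) - (\<Sum>a\<in>A. cnj (c a) * F (of_real a))"
        by (simp add: S_def that)
      hence "S F * cnj (S F) = (F z - (\<Sum>a\<in>A. c a * F (of_real a))) * (F (cnj z) - (\<Sum>a\<in>A. cnj (c a) * F (of_real a)))"
        by (simp add: S_def)
      also have "\<dots> = F z * F (cnj z) - F z * (\<Sum>a\<in>A. cnj (c a) * F (of_real a))
          - (\<Sum>a\<in>A. c a * F (of_real a)) * F (cnj z)
          + (\<Sum>a\<in>A. c a * F (of_real a)) * (\<Sum>b\<in>A. cnj (c b) * F (of_real b))"
        by (rule mult_diff_expand)
      also have "F z * (\<Sum>a\<in>A. cnj (c a) * F (of_real a)) = (\<Sum>a\<in>A. cnj (c a) * (F z * F (of_real a)))"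
        by (simp add: sum_distrib_left mult_ac)
      also have "(\<Sum>a\<in>A. c a * F (of_real a)) * F (cnj z) = (\<Sum>a\<in>A. c a * (F (of_real a) * F (cnj z)))"
        by (simp add: sum_distrib_left mult_ac)
      also have "(\<Sum>a\<in>A. c a * F (of_real a)) * (\<Sum>b\<in>A. cnj (c b) * F (of_real b)) =
          (\<Sum>a\<in>A. \<Sum>b\<in>A. c a * cnj (c b) * (F (of_real a) * F (of_real b)))"
        by (simp add: sum_product mult_ac)
      finally show ?thesis by (simp only: complex_norm_square)
    qed
    define p where "p = t powr (2 * \<mu> - 1)"
    have lin: "?comb (\<lambda>z w. of_real p * (G z * G w + of_real (\<mu> ^ 2) * (F z * F w))) =
        of_real p * (?comb (\<lambda>z w. G z * G w) + of_real (\<mu> ^ 2) * ?comb (\<lambda>z w. F z * F w))"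
      unfolding distrib_left right_diff_distrib sum_distrib_left sum.distrib
      by (simp add: mult_ac)
    have ed: "energy_deriv \<mu> z w t = of_real p * (G z * G w + of_real (\<mu> ^ 2) * (F z * F w))" for z w
      by (simp add: energy_deriv_def p_def F_def G_def)
    have SF: "?comb (\<lambda>z w. F z * F w) = of_real (norm (S F) ^ 2)"
      by (rule S) (rule cnjFG realFG)+
    have SG: "?comb (\<lambda>z w. G z * G w) = of_real (norm (S G) ^ 2)"
      by (rule S) (rule cnjFG realFG)+
    have "?comb (\<lambda>z w. energy_deriv \<mu> z w t) = of_real (p * (norm (S G) ^ 2 + \<mu> ^ 2 * norm (S F) ^ 2))"
      unfolding ed lin SF SG by simp
    moreover have "((\<lambda>t. ?comb (\<lambda>z w. energy \<mu> z w t)) has_vector_derivative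
        ?comb (\<lambda>z w. energy_deriv \<mu> z w t)) (at t)"
      by (intro derivative_intros energy_has_vector_derivative mu t(1) has_vector_derivative_mult_right)
    ultimately have "(P has_vector_derivative p * (norm (S G) ^ 2 + \<mu> ^ 2 * norm (S F) ^ 2)) (at t)"
      using bounded_linear.has_vector_derivative[OF bounded_linear_Re,
          of "\<lambda>t. ?comb (\<lambda>z w. energy \<mu> z w t)" "?comb (\<lambda>z w. energy_deriv \<mu> z w t)" "at t"]
      unfolding P_def by (simp only: Re_complex_of_real)
    moreover have "p * (norm (S G) ^ 2 + \<mu> ^ 2 * norm (S F) ^ 2) \<ge> 0" by (simp add: p_def)
    ultimately show "\<exists>y. (P has_real_derivative y) (at t) \<and> 0 \<le> y"
      unfolding has_real_derivative_iff_has_vector_derivative by blast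
  qed auto
  moreover have "P 0 = 0" by (simp add: P_def energy_0)
  moreover have "P 1 = Re (energy \<mu> z (cnj z) 1) - (\<Sum>a\<in>A. norm (E a) ^ 2 / N a)"
  proof -
    have c1: "c a * cnj (E a) = of_real (norm (E a) ^ 2 / N a)" for a
      by (simp add: c_def complex_norm_square del: of_real_power)
    have c2: "cnj (c a) * E a = of_real (norm (E a) ^ 2 / N a)" for a
      by (simp add: c_def complex_norm_square mult.commute del: of_real_power)
    have "(\<Sum>b\<in>A. c a * cnj (c b) * energy \<mu> (of_real a) (of_real b) 1) = of_real (norm (E a) ^ 2 / N a)"
      if a: "a \<in> A" for a
    proof -
      have "(\<Sum>b\<in>A. c a * cnj (c b) * energy \<mu> (of_real a) (of_real b) 1)
          = (\<Sum>b\<in>{a}. c a * cnj (c b) * energy \<mu> (of_real a) (of_real b) 1)"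
        using a A(1) orth by (intro sum.mono_neutral_right) auto
      also have "\<dots> = c a * cnj (E a)"
        using N[OF a] by (simp add: c_def)
      finally show ?thesis by (simp only: c1)
    qed
    hence e3: "(\<Sum>a\<in>A. \<Sum>b\<in>A. c a * cnj (c b) * energy \<mu> (of_real a) (of_real b) 1)
        = of_real (\<Sum>a\<in>A. norm (E a) ^ 2 / N a)"
      by (simp only: of_real_sum cong: sum.cong)
    have e2: "(\<Sum>a\<in>A. c a * energy \<mu> (of_real a) (cnj z) 1) = of_real (\<Sum>a\<in>A. norm (E a) ^ 2 / N a)"
      by (simp only: of_real_sum cnjE c1)
    have "energy \<mu> z (of_real a) 1 = E a" for a by (simp add: E_def)
    hence e1: "(\<Sum>a\<in>A. cnj (c a) * energy \<mu> z (of_real a) 1) = of_real (\<Sum>a\<in>A. norm (E a) ^ 2 / N a)"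
      by (simp only: of_real_sum c2)
    show ?thesis unfolding P_def e1 e2 e3 by simp
  qed
  ultimately show ?thesis using N by (simp add: E_def)
qed

section \<open>Removing the poles of the quotient\<close>

text \<open>
  Minus the residue of \<open>f / g\<close> at a zero \<open>a\<close> of \<open>g\<close>: there the system gives
  \<open>2 a g' a = (\<mu>\<^sup>2 - a) f a\<close>.
\<close>
definition resid :: "real \<Rightarrow> real \<Rightarrow> real" where
  "resid \<mu> a = 2 * a / (a - \<mu>\<^sup>2)"

definition zeros_upto :: "real \<Rightarrow> real \<Rightarrow> real set" where
  "zeros_upto \<mu> r = {a. bessel_g \<mu> a = 0 \<and> a \<le> r}"

lemma bessel_fg_holomorphic:
  assumes "\<mu> > 0"
  shows "bessel_f \<mu> holomorphic_on S" "bessel_g \<mu> holomorphic_on S"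
  unfolding holomorphic_on_def field_differentiable_def
  by (meson assms bessel_f_has_field_derivative bessel_g_has_field_derivative has_field_derivative_at_within)+

lemma finite_zeros_of_entire:
  fixes F :: "complex \<Rightarrow> complex"
  assumes hol: "F holomorphic_on UNIV" and "F 0 \<noteq> 0"
  shows "finite {z. norm z \<le> r \<and> F z = 0}"
proof (cases "\<forall>z. F z \<noteq> 0")
  case False
  with \<open>F 0 \<noteq> 0\<close> have "\<not> F constant_on UNIV"
    by (metis UNIV_I constant_on_def)
  with holomorphic_compact_finite_zeros[of F UNIV "cball 0 r"] hol
  have "finite {z\<in>cball 0 r. F z = 0}" by auto
  thus ?thesis by (rule rev_finite_subset) auto
qed auto

lemma finite_zeros_bessel_g:
  assumes mu: "\<mu> > 0"
  shows "finite {z. norm z \<le> r \<and> bessel_g \<mu> z = (0 :: complex)}"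
  using bcoef_0[OF mu] mu
  by (intro finite_zeros_of_entire bessel_fg_holomorphic) (simp_all add: bessel_g_0)

lemma zeros_upto_pos:
  assumes "\<mu> > 0" "a \<in> zeros_upto \<mu> r"
  shows "a > \<mu>\<^sup>2" "a > 0" "resid \<mu> a > 0"
proof -
  show a: "a > \<mu>\<^sup>2" using bessel_g_zero[OF assms(1)] assms(2) by (auto simp: zeros_upto_def)
  show "a > 0" using a zero_le_power2[of \<mu>] by linarith
  thus "resid \<mu> a > 0" using a by (simp add: resid_def)
qed

lemma finite_zeros_upto:
  assumes mu: "\<mu> > 0"
  shows "finite (zeros_upto \<mu> r)"
proof (rule finite_imageD)
  show "finite (complex_of_real ` zeros_upto \<mu> r)"
  proof (rule finite_subset[OF _ finite_zeros_bessel_g[OF mu, of r]], safe)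
    fix a assume a: "a \<in> zeros_upto \<mu> r"
    show "norm (complex_of_real a) \<le> r" "bessel_g \<mu> (complex_of_real a) = 0"
      using zeros_upto_pos[OF mu a] a by (auto simp: zeros_upto_def bessel_g_of_real[OF mu])
  qed
qed (auto simp: inj_on_def)

text \<open>
  Multiplied by \<open>\<bar>g z\<bar>\<^sup>2 / (Im z)\<^sup>2\<close>, the left-hand side is exactly the difference of the two sides of
  \<open>bessel_inequality\<close>: the quotient \<open>f / g\<close> contributes the energy of \<open>t\<^sup>\<mu> f (z t\<^sup>2)\<close>, and each principal
  part one squared Fourier coefficient.
\<close>
lemma herglotz_remainder:
  assumes mu: "\<mu> > 0" and A: "finite A" "\<And>a. a \<in> A \<Longrightarrow> bessel_g \<mu> a = 0" and z: "Im z \<noteq> 0"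
  shows "Im z * Im (z * (bessel_f \<mu> z / bessel_g \<mu> z - (\<Sum>a\<in>A. of_real (resid \<mu> a) / (of_real a - z)))) \<ge> 0"
proof -
  define f where "f = bessel_f \<mu> z"
  define g where "g = bessel_g \<mu> z"
  have g0: "g \<noteq> 0"
    using bessel_g_zero_imp_real[OF mu, of z] z by (auto simp: g_def complex_is_Real_iff)
  have ne: "z \<noteq> cnj z" using z by (auto simp: complex_eq_iff)
  have 1: "Re (energy \<mu> z (cnj z) 1) * Im z = norm g ^ 2 * Im (z * (f / g))"
  proof -
    define X where "X = z * f * cnj g"
    have "energy \<mu> z (cnj z) 1 = (X - cnj X) / (z - cnj z)"
      using ne by (simp add: energy_def Let_def X_def f_def g_def bessel_f_cnj[OF mu] bessel_g_cnj[OF mu] mult_ac)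
    also have "\<dots> = of_real (Im X / Im z)"
      using z by (simp add: complex_diff_cnj)
    finally have eq: "Re (energy \<mu> z (cnj z) 1) * Im z = Im X"
      using z by simp
    have X: "X = of_real (norm g ^ 2) * (z * (f / g))"
      using g0 by (simp only: X_def complex_norm_square) (simp add: field_simps)
    have "Im X = norm g ^ 2 * Im (z * (f / g))"
      unfolding X by (simp only: times_complex.simps Re_complex_of_real Im_complex_of_real mult_zero_left add_0_right)
    thus ?thesis using eq by (simp only:)
  qed
  have 2: "norm (energy \<mu> z (of_real a) 1) ^ 2 / Re (energy \<mu> (of_real a) (of_real a) 1)
      = norm g ^ 2 * (resid \<mu> a * a / norm (of_real a - z) ^ 2)" if "a \<in> A" for a
  proof -
    have fa: "bessel_f \<mu> a \<noteq> 0" and a: "a > \<mu>\<^sup>2" using bessel_g_zero[OF mu A(2)[OF that]] by auto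
    have "z \<noteq> of_real a" using z by auto
    hence "energy \<mu> z (of_real a) 1 = of_real (a * bessel_f \<mu> a) * g / (of_real a - z)"
      using A(2)[OF that] mu
      by (simp add: energy_def Let_def bessel_g_of_real bessel_f_of_real g_def divide_simps)
         (simp add: algebra_simps)
    hence "norm (energy \<mu> z (of_real a) 1) ^ 2
       = a ^ 2 * bessel_f \<mu> a ^ 2 * norm g ^ 2 / norm (of_real a - z) ^ 2"
      by (simp add: norm_mult norm_divide power_mult_distrib power_divide)
    moreover have "(a ^ 2 * F ^ 2 * G / d) / (k * F ^ 2 / 2) = G * ((2 * a / k) * a / d)"
      if "F \<noteq> 0" "k \<noteq> 0" for F G d k :: real
      using that by (cases "d = 0") (simp_all add: field_simps power2_eq_square)
    ultimately show ?thesis using fa a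
      by (simp add: energy_diag_zero[OF mu A(2)[OF that]] resid_def del: of_real_mult of_real_diff of_real_divide of_real_power)
  qed
  have 3: "Im (z * (of_real (resid \<mu> a) / (of_real a - z)))
      = Im z * (resid \<mu> a * a / norm (of_real a - z) ^ 2)" if "a \<in> A" for a
  proof -
    define d where "d = of_real a - z"
    have d: "d \<noteq> 0" "z = of_real a - d" "Im d = - Im z" using z by (auto simp: d_def)
    have "(of_real a - d) * (of_real (resid \<mu> a) / d) = of_real (resid \<mu> a * a) * inverse d - of_real (resid \<mu> a)"
      using d(1) by (simp add: field_simps)
    hence "Im (z * (of_real (resid \<mu> a) / d)) = resid \<mu> a * a * Im (inverse d)"
      unfolding d(2)[symmetric] by simp
    also have "Im (inverse d) = Im z / norm d ^ 2"
      by (simp add: cmod_power2 d(3))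
    finally show ?thesis by (simp add: d_def)
  qed
  have "norm g ^ 2 * (Im z * Im (z * (f / g - (\<Sum>a\<in>A. of_real (resid \<mu> a) / (of_real a - z)))))
     = Im z * (norm g ^ 2 * Im (z * (f / g))) -
       Im z * (norm g ^ 2 * (\<Sum>a\<in>A. Im (z * (of_real (resid \<mu> a) / (of_real a - z)))))"
    by (simp only: right_diff_distrib sum_distrib_left minus_complex.simps Im_sum) (simp add: mult_ac)
  also have "\<dots> = Im z ^ 2 * (Re (energy \<mu> z (cnj z) 1) -
      (\<Sum>a\<in>A. norm (energy \<mu> z (of_real a) 1) ^ 2 / Re (energy \<mu> (of_real a) (of_real a) 1)))"
    by (simp only: 1[symmetric] 2 3 cong: sum.cong)
       (simp add: sum_distrib_left power2_eq_square algebra_simps)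
  also have "\<dots> \<ge> 0"
    using bessel_inequality[OF mu A z] by simp
  finally have "0 \<le> norm g ^ 2 * (Im z * Im (z * (f / g - (\<Sum>a\<in>A. of_real (resid \<mu> a) / (of_real a - z)))))" .
  thus ?thesis using g0 unfolding f_def g_def
    by (simp add: zero_le_mult_iff)
qed

text \<open>
  The zeros of \<open>g\<close> are simple, since \<open>f\<close> and \<open>\<mu>\<^sup>2 - a\<close> do not vanish there; hence
  subtracting the principal parts leaves removable singularities.
\<close>
lemma pole_cancellation:
  assumes mu: "\<mu> > 0"
  obtains H where "H analytic_on cball 0 r"
    "\<And>z. norm z \<le> r \<Longrightarrow> bessel_g \<mu> z \<noteq> 0 \<Longrightarrow>
       H z = bessel_f \<mu> z / bessel_g \<mu> z - (\<Sum>a\<in>zeros_upto \<mu> r. of_real (resid \<mu> a) / (of_real a - z))"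
proof -
  define A where "A = zeros_upto \<mu> r"
  define Q where "Q = (\<lambda>z::complex. bessel_f \<mu> z / bessel_g \<mu> z - (\<Sum>a\<in>A. of_real (resid \<mu> a) / (of_real a - z)))"
  define T where "T = {z. norm z \<le> r + 1 \<and> bessel_g \<mu> z = (0 :: complex)}"
  have finT: "finite T" unfolding T_def by (rule finite_zeros_bessel_g[OF mu])
  have finA: "finite A" unfolding A_def by (rule finite_zeros_upto[OF mu])
  have gA: "bessel_g \<mu> (complex_of_real a) = 0" if "a \<in> A" for a
    using that by (simp add: A_def zeros_upto_def bessel_g_of_real[OF mu])
  have holQ: "Q holomorphic_on S" if "S \<inter> T = {}" "S \<subseteq> ball 0 (r+1)" for S
  proof -
    have g0: "bessel_g \<mu> z \<noteq> 0" if "z \<in> S" for z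
      using \<open>S \<inter> T = {}\<close> \<open>S \<subseteq> ball 0 (r+1)\<close> that by (force simp: T_def)
    have "complex_of_real a - z \<noteq> 0" if "z \<in> S" "a \<in> A" for z a
      using g0[OF that(1)] gA[OF that(2)] by auto
    with g0 show ?thesis unfolding Q_def
      by (intro holomorphic_intros bessel_fg_holomorphic[OF mu]) auto
  qed
  have iso: "isolated_singularity_at Q z" if "norm z \<le> r" for z
  proof (rule isolated_singularity_at_holomorphic)
    show "open (ball 0 (r+1) - (T - {z}))" using finT by (intro open_Diff finite_imp_closed) auto
    show "Q holomorphic_on ball 0 (r+1) - (T - {z}) - {z}" by (rule holQ) auto
  qed (use that in auto)
  have an: "Q analytic_on {z}" if "norm z \<le> r" "bessel_g \<mu> z \<noteq> 0" for z
  proof -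
    have "open (ball 0 (r+1) - T)" using finT by (intro open_Diff finite_imp_closed) auto
    moreover have "Q holomorphic_on ball 0 (r+1) - T" by (rule holQ) auto
    moreover have "z \<in> ball 0 (r+1) - T" using that by (auto simp: T_def)
    ultimately show ?thesis by (meson analytic_at)
  qed
  have lim: "\<exists>c. Q \<midarrow>z\<rightarrow> c" if z: "norm z \<le> r" "bessel_g \<mu> z = 0" for z
  proof -
    obtain a where a: "z = of_real a" using bessel_g_zero_imp_real[OF mu z(2)] by (auto elim: Reals_cases)
    have ga: "bessel_g \<mu> a = 0" using z(2) by (simp add: a bessel_g_of_real[OF mu])
    note az = bessel_g_zero[OF mu ga]
    have a0: "a > 0" using az(1) zero_le_power2[of \<mu>] by linarith
    have aA: "a \<in> A" using z(1) ga by (auto simp: A_def zeros_upto_def a)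
    define S where "S = ball 0 (r+1) - (T - {z})"
    have S: "open S" "z \<in> S" unfolding S_def using finT z by (auto intro!: open_Diff finite_imp_closed)
    have "Q holomorphic_on S - {z}" unfolding S_def by (rule holQ) auto
    moreover have "((\<lambda>w. (w - z) * Q w) \<longlongrightarrow> 0) (at z)"
    proof -
      have "2 * z * bessel_g' \<mu> z = of_real ((\<mu>\<^sup>2 - a) * bessel_f \<mu> a)"
        using bessel_g_deriv_eq[OF mu, of z] z(2) by (simp add: a bessel_f_of_real[OF mu])
      hence g': "bessel_g' \<mu> z = of_real ((\<mu>\<^sup>2 - a) * bessel_f \<mu> a / (2 * a))"
        using a0 by (simp add: a field_simps)
      have g'0: "bessel_g' \<mu> z \<noteq> 0" unfolding g' of_real_eq_0_iff using a0 az by simp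
      have "((\<lambda>w. (bessel_g \<mu> w - bessel_g \<mu> z) / (w - z)) \<longlongrightarrow> bessel_g' \<mu> z) (at z)"
        using bessel_g_has_field_derivative[OF mu, of z] unfolding has_field_derivative_iff .
      moreover have "(bessel_f \<mu> \<longlongrightarrow> bessel_f \<mu> z) (at z)"
        using DERIV_isCont[OF bessel_f_has_field_derivative[OF mu]] isContD by blast
      ultimately have "((\<lambda>w. bessel_f \<mu> w / ((bessel_g \<mu> w - bessel_g \<mu> z) / (w - z)))
          \<longlongrightarrow> bessel_f \<mu> z / bessel_g' \<mu> z) (at z)"
        by (intro tendsto_divide g'0)
      also have "bessel_f \<mu> z / bessel_g' \<mu> z = - of_real (resid \<mu> a)"
      proof -
        have "bessel_f \<mu> a / ((\<mu>\<^sup>2 - a) * bessel_f \<mu> a / (2 * a)) = - resid \<mu> a"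
          using az a0 by (simp add: resid_def divide_simps) (simp add: algebra_simps)
        moreover have "bessel_f \<mu> z = of_real (bessel_f \<mu> a)"
          by (simp add: a bessel_f_of_real[OF mu])
        ultimately show ?thesis
          by (simp only: g' of_real_divide[symmetric] of_real_minus[symmetric])
      qed
      finally have 1: "((\<lambda>w. bessel_f \<mu> w / ((bessel_g \<mu> w - bessel_g \<mu> z) / (w - z)))
          \<longlongrightarrow> - of_real (resid \<mu> a)) (at z)" .
      have lim_rest: "((\<lambda>w. \<Sum>b\<in>A-{a}. of_real (resid \<mu> b) / (of_real b - w)) \<longlongrightarrow>
          (\<Sum>b\<in>A-{a}. of_real (resid \<mu> b) / (of_real b - z))) (at z)"
        by (intro tendsto_intros) (auto simp: a)
      have 2: "((\<lambda>w. (w - z) * (\<Sum>b\<in>A-{a}. of_real (resid \<mu> b) / (of_real b - w))) \<longlongrightarrow>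
          (z - z) * (\<Sum>b\<in>A-{a}. of_real (resid \<mu> b) / (of_real b - z))) (at z)"
        by (rule tendsto_mult[OF tendsto_diff[OF tendsto_ident_at tendsto_const] lim_rest])
      have "((\<lambda>w. bessel_f \<mu> w / ((bessel_g \<mu> w - bessel_g \<mu> z) / (w - z)) + of_real (resid \<mu> a) -
           (w - z) * (\<Sum>b\<in>A-{a}. of_real (resid \<mu> b) / (of_real b - w))) \<longlongrightarrow>
          - of_real (resid \<mu> a) + of_real (resid \<mu> a) - (z - z) * (\<Sum>b\<in>A-{a}. of_real (resid \<mu> b) / (of_real b - z))) (at z)"
        by (intro tendsto_intros 1 2)
      hence "((\<lambda>w. bessel_f \<mu> w / ((bessel_g \<mu> w - bessel_g \<mu> z) / (w - z)) + of_real (resid \<mu> a) -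
           (w - z) * (\<Sum>b\<in>A-{a}. of_real (resid \<mu> b) / (of_real b - w))) \<longlongrightarrow> 0) (at z)"
        by simp
      moreover have "eventually (\<lambda>w. bessel_f \<mu> w / ((bessel_g \<mu> w - bessel_g \<mu> z) / (w - z)) + of_real (resid \<mu> a) -
           (w - z) * (\<Sum>b\<in>A-{a}. of_real (resid \<mu> b) / (of_real b - w)) = (w - z) * Q w) (at z)"
      proof -
        have "eventually (\<lambda>w. w \<noteq> z) (at z)" by (rule eventually_neq_at_within)
        thus ?thesis
        proof eventually_elim
          case (elim w)
          have "Q w = bessel_f \<mu> w / bessel_g \<mu> w - (of_real (resid \<mu> a) / (of_real a - w)
              + (\<Sum>b\<in>A-{a}. of_real (resid \<mu> b) / (of_real b - w)))"
            unfolding Q_def by (subst sum.remove[OF finA aA]) simp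
          moreover have "(w - z) * (of_real (resid \<mu> a) / (of_real a - w)) = - of_real (resid \<mu> a)"
            using elim by (simp add: a divide_simps) (simp add: algebra_simps)
          ultimately show ?case
            by (simp only: right_diff_distrib distrib_left z(2)) simp
        qed
      qed
      ultimately show ?thesis by (rule Lim_transform_eventually)
    qed
    ultimately obtain q where q: "q holomorphic_on S" "\<And>w. w \<in> S - {z} \<Longrightarrow> q w = Q w"
      using holomorphic_on_extend_lim[of Q S z] S by (auto simp: interior_open)
    have "q \<midarrow>z\<rightarrow> q z"
      using holomorphic_on_imp_continuous_on[OF q(1)] S
      by (simp add: continuous_on_eq_continuous_at isContD)
    moreover have "eventually (\<lambda>w. w \<in> S - {z}) (at z)"
      using S by (rule eventually_at_in_open)
    hence "eventually (\<lambda>w. q w = Q w) (at z)"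
      by eventually_elim (rule q)
    ultimately have "Q \<midarrow>z\<rightarrow> q z" by (rule Lim_transform_eventually)
    thus ?thesis ..
  qed
  show ?thesis
  proof (rule that)
    show "remove_sings Q analytic_on cball 0 r"
    proof (subst analytic_on_analytic_at, safe)
      fix z :: complex assume "z \<in> cball 0 r"
      hence z: "norm z \<le> r" by simp
      show "remove_sings Q analytic_on {z}"
      proof (cases "bessel_g \<mu> z = 0")
        case True
        with lim[OF z] show ?thesis using remove_sings_analytic_at[OF iso[OF z]] by blast
      next
        case False
        with an[OF z] show ?thesis by (intro remove_sings_analytic_on)
      qed
    qed
    show "remove_sings Q z = bessel_f \<mu> z / bessel_g \<mu> z - (\<Sum>a\<in>zeros_upto \<mu> r. of_real (resid \<mu> a) / (of_real a - z))"
      if "norm z \<le> r" "bessel_g \<mu> z \<noteq> 0" for z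
      using remove_sings_at_analytic[OF an[OF that]] by (simp add: Q_def A_def)
  qed
qed

section \<open>The remainder is nearly constant\<close>

text \<open>
  A Harnack-type estimate: the map \<open>w \<mapsto> (w - c) / (w + c)\<close> takes the right half plane to the unit disc, and the
  Schwarz lemma applies to its composition with \<open>P\<close>.
\<close>
lemma nonneg_Re_near_center:
  fixes P :: "complex \<Rightarrow> complex" and c r :: real
  assumes hol: "P holomorphic_on ball 0 r" and r: "r > 0"
    and nonneg: "\<And>z. norm z < r \<Longrightarrow> Re (P z) \<ge> 0" and P0: "P 0 = of_real c"
    and z: "norm z < r"
  shows "norm (P z - of_real c) \<le> 2 * c * (norm z / (r - norm z))"
proof -
  define s where "s = norm z / r"
  have s: "0 \<le> s" "s < 1" using z r by (auto simp: s_def)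
  have c: "c \<ge> 0" using nonneg[of 0] r by (simp add: P0)
  \<comment> \<open>shifting by a positive number makes the real part strictly positive, also when the function vanishes\<close>
  have step: "norm (P z - of_real c) \<le> 2 * (c + e) * (s / (1 - s))" if e: "e > 0" for e
  proof -
    define \<phi> where "\<phi> = (\<lambda>w. (P (of_real r * w) - of_real c) / (P (of_real r * w) + of_real (c + 2 * e)))"
    have in_ball: "norm (of_real r * w) < r" if "norm w < 1" for w :: complex
      using that r by (simp add: norm_mult)
    have den: "P (of_real r * w) + of_real (c + 2 * e) \<noteq> 0" if "norm w < 1" for w
    proof
      assume "P (of_real r * w) + of_real (c + 2 * e) = 0"
      hence "Re (P (of_real r * w) + of_real (c + 2 * e)) = 0" by simp
      thus False using nonneg[OF in_ball[OF that]] c e by simp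
    qed
    have "\<phi> holomorphic_on ball 0 1"
    proof -
      have "(\<lambda>w. P (of_real r * w)) holomorphic_on ball 0 1"
        by (rule holomorphic_on_compose_gen[OF _ hol, unfolded o_def])
           (auto intro!: holomorphic_intros in_ball)
      thus ?thesis unfolding \<phi>_def using den by (intro holomorphic_intros) auto
    qed
    moreover have "\<phi> 0 = 0" by (simp add: \<phi>_def P0)
    moreover have "norm (\<phi> w) < 1" if w: "norm w < 1" for w
    proof -
      let ?p = "P (of_real r * w)"
      have "norm (?p - of_real c) ^ 2 < norm (?p + of_real (c + 2 * e)) ^ 2"
      proof -
        have "(Re ?p + (c + 2 * e)) ^ 2 - (Re ?p - c) ^ 2 = 4 * (c + e) * (Re ?p + e)"
          by (simp add: power2_eq_square algebra_simps)
        moreover have "4 * (c + e) * (Re ?p + e) > 0"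
          using c e nonneg[OF in_ball[OF w]] by (intro mult_pos_pos) auto
        ultimately show ?thesis by (simp add: cmod_power2)
      qed
      hence "norm (?p - of_real c) < norm (?p + of_real (c + 2 * e))"
        by (rule power2_less_imp_less) simp
      thus ?thesis using den[OF w] by (simp add: \<phi>_def norm_divide)
    qed
    moreover have "norm (z / of_real r) < 1" using z r by (simp add: norm_divide)
    ultimately have "norm (\<phi> (z / of_real r)) \<le> norm (z / of_real r)"
      by (rule Schwarz_Lemma(1))
    hence le: "norm (\<phi> (z / of_real r)) \<le> s" using r by (simp add: s_def norm_divide)
    define q where "q = \<phi> (z / of_real r)"
    have q: "q = (P z - of_real c) / (P z + of_real (c + 2 * e))" and "P z + of_real (c + 2 * e) \<noteq> 0"
      using r den[of "z / of_real r"] \<open>norm (z / of_real r) < 1\<close> by (auto simp: q_def \<phi>_def)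
    hence "P z - of_real c = q * (P z + of_real (c + 2 * e))" by simp
    hence eq: "(P z - of_real c) * (1 - q) = 2 * of_real (c + e) * q" by (simp add: algebra_simps)
    have "norm (P z - of_real c) * (1 - s) \<le> norm (P z - of_real c) * norm (1 - q)"
      using le norm_triangle_ineq2[of 1 q] by (intro mult_left_mono) (auto simp: q_def)
    also have "\<dots> = norm (2 * of_real (c + e) * q)" using eq by (simp only: norm_mult[symmetric])
    also have "\<dots> = 2 * (c + e) * norm q"
      using c e by (simp add: norm_mult del: of_real_add)
    also have "\<dots> \<le> 2 * (c + e) * s"
      using le c e by (intro mult_left_mono) (auto simp: q_def)
    finally show ?thesis using s by (simp add: field_simps)
  qed
  have "((\<lambda>e. 2 * (c + e) * (s / (1 - s))) \<longlongrightarrow> 2 * (c + 0) * (s / (1 - s))) (at_right 0)"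
    by (intro tendsto_intros)
  moreover have "eventually (\<lambda>e. norm (P z - of_real c) \<le> 2 * (c + e) * (s / (1 - s))) (at_right 0)"
    using step eventually_at_right_less[of 0] by (rule eventually_mono[rotated])
  ultimately have "norm (P z - of_real c) \<le> 2 * (c + 0) * (s / (1 - s))"
    by (intro tendsto_lowerbound) auto
  also have "s / (1 - s) = norm z / (r - norm z)"
    using r z by (simp add: s_def field_simps)
  finally show ?thesis by simp
qed

text \<open>
  On the circle \<open>\<bar>z\<bar> = r\<close> one has \<open>(r\<^sup>2 - z\<^sup>2) / z = cnj z - z\<close>, which is purely imaginary. Therefore the
  sign of \<open>Im z * Im (z * H z)\<close> is the sign of the real part of \<open>(r\<^sup>2 - z\<^sup>2) H z\<close>, and the latter extends into
  the disc by the maximum principle. The factor \<open>1 - z\<^sup>2 / r\<^sup>2\<close> tends to \<open>1\<close> on compact sets.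
\<close>
lemma typically_real_nearly_constant:
  fixes H :: "complex \<Rightarrow> complex" and c r M :: real
  assumes H: "H analytic_on cball 0 r" and M: "M > 0" "r \<ge> 2 * M"
    and sphere: "\<And>z. norm z = r \<Longrightarrow> Im z * Im (z * H z) \<ge> 0" and H0: "H 0 = of_real c"
    and z: "norm z \<le> M"
  shows "c \<ge> 0" "norm (H z - of_real c) \<le> 6 * c * M / r"
proof -
  have r: "r > 0" using M by linarith
  define P where "P = (\<lambda>z. (1 - z ^ 2 / of_real r ^ 2) * H z)"
  have an: "P analytic_on cball 0 r" unfolding P_def
    using r H by (intro analytic_intros) auto
  have holP: "P holomorphic_on ball 0 r"
    using analytic_imp_holomorphic[OF analytic_on_subset[OF an]] by auto
  have bd: "Re (P w) \<ge> 0" if w: "norm w = r" for w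
  proof -
    have "of_real r ^ 2 = w * cnj w" using complex_norm_square[of w] w by simp
    hence "of_real r ^ 2 - w ^ 2 = (cnj w - w) * w"
      by (simp add: power2_eq_square algebra_simps)
    also have "cnj w - w = - (2 * \<i> * of_real (Im w))"
      by (simp add: complex_eq_iff)
    finally have eq: "of_real r ^ 2 - w ^ 2 = - (2 * \<i> * of_real (Im w)) * w" .
    have "P w = (of_real r ^ 2 - w ^ 2) * H w / of_real (r ^ 2)"
      using r by (simp add: P_def field_simps)
    hence "P w = - (2 * \<i> * of_real (Im w)) * (w * H w) / of_real (r ^ 2)"
      by (simp only: eq mult.assoc)
    hence "Re (P w) = 2 * (Im w * Im (w * H w)) / r ^ 2"
      unfolding Re_divide_of_real by simp
    thus ?thesis using sphere[OF w] by simp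
  qed
  have nonneg: "Re (P w) \<ge> 0" if w: "norm w < r" for w
  proof -
    have "Re (- P w) \<le> 0"
    proof (rule maximum_real_frontier[where S = "cball 0 r" and f = "\<lambda>z. - P z" and B = 0 and \<xi> = w])
      show "(\<lambda>z. - P z) holomorphic_on interior (cball 0 r)"
        using holP by (auto intro: holomorphic_intros)
      show "continuous_on (closure (cball 0 r)) (\<lambda>z. - P z)"
        using holomorphic_on_imp_continuous_on[OF analytic_imp_holomorphic[OF an]] by (auto intro: continuous_intros)
      show "Re (- P z) \<le> 0" if "z \<in> frontier (cball 0 r)" for z
        using that bd[of z] r by simp
    qed (use w in auto)
    thus ?thesis by simp
  qed
  have P0: "P 0 = of_real c" by (simp add: P_def H0)
  show c: "c \<ge> 0" using nonneg[of 0] r by (simp add: P0)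
  have zr: "norm z < r" using z M by linarith
  define k where "k = M / r"
  have k: "0 < k" "k \<le> 1 / 2" "M = k * r" using M r by (auto simp: k_def)
  have "norm (P z - of_real c) \<le> 2 * c * (norm z / (r - norm z))"
    by (rule nonneg_Re_near_center[OF holP r nonneg P0 zr])
  also have "norm z / (r - norm z) \<le> M / (r - M)"
    using z M r zr by (intro frac_le) auto
  also have "M / (r - M) \<le> 2 * k"
  proof -
    have "M \<le> 2 * k * (r - M)"
    proof -
      have "2 * k * (r - M) - M = k * r * (1 - 2 * k)" by (simp add: k(3) algebra_simps)
      also have "\<dots> \<ge> 0" using k r by simp
      finally show ?thesis by simp
    qed
    thus ?thesis using M by (simp add: pos_divide_le_eq)
  qed
  finally have 1: "norm (P z - of_real c) \<le> 4 * c * k"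
    using c by (simp add: mult_left_mono)
  define u where "u = z ^ 2 / of_real r ^ 2"
  have u: "norm u \<le> k ^ 2"
    using z r by (simp add: u_def k_def norm_divide norm_power power_divide[symmetric] power_mono divide_right_mono)
  have k2: "k ^ 2 \<le> k / 2" using k by (simp add: power2_eq_square)
  have "norm (H z - of_real c) * (3 / 4) \<le> norm (H z - of_real c) * norm (1 - u)"
    using u k k2 norm_triangle_ineq2[of 1 u] by (intro mult_left_mono) auto
  also have "\<dots> = norm (P z - of_real c + of_real c * u)"
  proof -
    have "P z = (1 - u) * H z" by (simp add: P_def u_def)
    hence "(H z - of_real c) * (1 - u) = P z - of_real c + of_real c * u" by (simp add: algebra_simps)
    thus ?thesis by (simp only: norm_mult[symmetric])
  qed
  also have "\<dots> \<le> 4 * c * k + c * (k / 2)"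
  proof (intro order_trans[OF norm_triangle_ineq] add_mono 1)
    have "norm u \<le> k / 2" using u k2 by simp
    thus "norm (of_real c * u) \<le> c * (k / 2)" using c by (simp add: norm_mult mult_left_mono del: times_divide_eq_right)
  qed
  finally have "norm (H z - of_real c) \<le> 6 * (c * k)" by simp
  thus "norm (H z - of_real c) \<le> 6 * c * M / r" by (simp add: k_def)
qed

text \<open>
  The system gives \<open>2 x (f' g - f g') = g\<^sup>2 - (\<mu>\<^sup>2 - x) f\<^sup>2\<close>, which is \<open>x f\<^sup>2\<close> under the assumption
  on \<open>x\<close>; this is where the value of the sum comes from.
\<close>
lemma deriv_quotient:
  assumes mu: "\<mu> > 0" and x: "x > 0" "bessel_g \<mu> x = - \<mu> * bessel_f \<mu> x"
  shows "bessel_g \<mu> (complex_of_real x) \<noteq> 0"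
    and "((\<lambda>z. bessel_f \<mu> z / bessel_g \<mu> z) has_field_derivative of_real (1 / (2 * \<mu>\<^sup>2))) (at (complex_of_real x))"
proof -
  define F where "F = bessel_f \<mu> (complex_of_real x)"
  define G where "G = bessel_g \<mu> (complex_of_real x)"
  define F' where "F' = bessel_f' \<mu> (complex_of_real x)"
  define G' where "G' = bessel_g' \<mu> (complex_of_real x)"
  have G: "G = - of_real \<mu> * F"
    using x(2) by (simp add: F_def G_def bessel_f_of_real[OF mu] bessel_g_of_real[OF mu])
  have fx: "bessel_f \<mu> x \<noteq> 0" using bessel_g_zero(2)[OF mu, of x] x(2) by auto
  hence F: "F \<noteq> 0" by (simp add: F_def bessel_f_of_real[OF mu])
  thus G0: "bessel_g \<mu> (complex_of_real x) \<noteq> 0" using G mu by (simp add: G_def)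
  have 1: "2 * of_real x * F' = G - of_real \<mu> * F"
    using bessel_f_deriv_eq[of "complex_of_real x" \<mu>] by (simp add: F_def G_def F'_def)
  have 2: "2 * of_real x * G' = (of_real \<mu> ^ 2 - of_real x) * F - of_real \<mu> * G"
    using bessel_g_deriv_eq[OF mu, of "complex_of_real x"] by (simp add: F_def G_def G'_def)
  have "2 * of_real x * (F' * G - F * G') = (2 * of_real x * F') * G - F * (2 * of_real x * G')"
    by (simp add: algebra_simps)
  also have "\<dots> = 2 * of_real x * (F ^ 2 / 2)"
    unfolding 1 2 G by (simp add: power2_eq_square algebra_simps)
  finally have num: "F' * G - F * G' = F ^ 2 / 2"
    using x(1) by (simp only: mult_cancel_left) simp
  have "(F' * G - F * G') / (G * G) = of_real (1 / (2 * \<mu>\<^sup>2))"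
    unfolding num using F mu by (simp add: G power2_eq_square)
  moreover have "((\<lambda>z. bessel_f \<mu> z / bessel_g \<mu> z) has_field_derivative (F' * G - F * G') / (G * G)) (at (of_real x))"
    unfolding F_def G_def F'_def G'_def
    by (intro DERIV_divide bessel_f_has_field_derivative bessel_g_has_field_derivative mu G0)
  ultimately show "((\<lambda>z. bessel_f \<mu> z / bessel_g \<mu> z) has_field_derivative of_real (1 / (2 * \<mu>\<^sup>2))) (at (complex_of_real x))"
    by simp
qed

text \<open>
  The left-hand side is \<open>\<bar>H' x\<bar>\<close> for the remainder \<open>H\<close> in the disc of radius \<open>r\<close>; the value \<open>H 0\<close> is
  at most \<open>f 0 / g 0 = 1 / \<mu>\<close> because the subtracted terms are positive at \<open>0\<close>.
\<close>
lemma partial_sum_bound: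
  assumes mu: "\<mu> > 0" and x: "x > 0" "bessel_g \<mu> x = - \<mu> * bessel_f \<mu> x"
    and r: "r \<ge> 2 * (x + 2)"
  shows "\<bar>1 / (2 * \<mu>\<^sup>2) - (\<Sum>a\<in>zeros_upto \<mu> r. resid \<mu> a / (a - x) ^ 2)\<bar> \<le> 6 * (x + 2) / (\<mu> * r)"
proof -
  define A where "A = zeros_upto \<mu> r"
  have finA: "finite A" unfolding A_def by (rule finite_zeros_upto[OF mu])
  have Apos: "a > 0" "resid \<mu> a > 0" "bessel_g \<mu> a = 0" if "a \<in> A" for a
    using zeros_upto_pos[OF mu that[unfolded A_def]] that by (auto simp: A_def zeros_upto_def)
  obtain H where H: "H analytic_on cball 0 r" and
    Heq: "\<And>z. norm z \<le> r \<Longrightarrow> bessel_g \<mu> z \<noteq> 0 \<Longrightarrow>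
       H z = bessel_f \<mu> z / bessel_g \<mu> z - (\<Sum>a\<in>A. of_real (resid \<mu> a) / (of_real a - z))"
    using pole_cancellation[OF mu, of r] unfolding A_def by metis
  define c where "c = 1 / \<mu> - (\<Sum>a\<in>A. resid \<mu> a / a)"
  have "(\<Sum>a\<in>A. resid \<mu> a / a) \<ge> 0"
    using Apos by (intro sum_nonneg divide_nonneg_nonneg) (auto intro: less_imp_le)
  hence "c \<le> 1 / \<mu>" by (simp add: c_def)
  have H0: "H 0 = of_real c"
    using Heq[of 0] r x(1) mu bcoef_0[OF mu] by (simp add: c_def bessel_f_0 bessel_g_0)
  have sphere: "Im z * Im (z * H z) \<ge> 0" if z: "norm z = r" for z
  proof (cases "Im z = 0")
    case False
    hence "bessel_g \<mu> z \<noteq> 0"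
      using bessel_g_zero_imp_real[OF mu, of z] by (auto simp: complex_is_Real_iff)
    thus ?thesis using herglotz_remainder[OF mu finA Apos(3) False] Heq[of z] z by simp
  qed auto
  have const: "c \<ge> 0" "norm (H z - of_real c) \<le> 6 * c * (x + 2) / r" if "norm z \<le> x + 2" for z
    using typically_real_nearly_constant[OF H _ r sphere H0 that] x(1) by auto
  define B where "B = 6 * (x + 2) / (\<mu> * r)"
  have B: "norm (H z - of_real c) \<le> B" if "norm z \<le> x + 2" for z
  proof -
    have "norm (H z - of_real c) \<le> c * (6 * (x + 2) / r)"
      using const(2)[OF that] by (simp add: mult_ac)
    also have "\<dots> \<le> (1 / \<mu>) * (6 * (x + 2) / r)"
      using \<open>c \<le> 1 / \<mu>\<close> r x(1) by (intro mult_right_mono) auto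
    finally show ?thesis by (simp add: B_def)
  qed
  have sub: "cball (complex_of_real x) 1 \<subseteq> ball 0 r"
  proof
    fix w assume "w \<in> cball (complex_of_real x) 1"
    hence "norm (w - of_real x) \<le> 1" by (simp add: dist_norm norm_minus_commute)
    hence "norm w \<le> x + 1" using norm_triangle_sub[of w "of_real x"] x(1) by simp
    thus "w \<in> ball 0 r" using r x(1) by simp
  qed
  have anH: "(\<lambda>z. H z - of_real c) analytic_on cball 0 r" by (intro analytic_intros H)
  have "norm ((deriv ^^ 1) (\<lambda>z. H z - of_real c) (of_real x)) \<le> fact 1 * B / 1 ^ 1"
  proof (rule Cauchy_inequality)
    show "(\<lambda>z. H z - of_real c) holomorphic_on ball (of_real x) 1"
      by (rule analytic_imp_holomorphic, rule analytic_on_subset[OF anH])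
         (use sub ball_subset_cball[of "complex_of_real x" 1] ball_subset_cball[of 0 r] in blast)
    show "continuous_on (cball (of_real x) 1) (\<lambda>z. H z - of_real c)"
      by (rule holomorphic_on_imp_continuous_on, rule analytic_imp_holomorphic, rule analytic_on_subset[OF anH])
         (use sub ball_subset_cball[of "complex_of_real x" 1] ball_subset_cball[of 0 r] in blast)
    fix w assume "norm (complex_of_real x - w) = 1"
    hence "norm w \<le> x + 2" using norm_triangle_sub[of w "of_real x"] x(1) by (simp add: norm_minus_commute)
    thus "norm (H w - of_real c) \<le> B" by (rule B)
  qed auto
  moreover have "deriv (\<lambda>z. H z - of_real c) (of_real x) =
      of_real (1 / (2 * \<mu>\<^sup>2) - (\<Sum>a\<in>A. resid \<mu> a / (a - x) ^ 2))"
  proof (rule DERIV_imp_deriv)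
    note dq = deriv_quotient[OF mu x]
    have "x \<notin> A"
      using Apos(3)[of x] dq(1) by (auto simp: bessel_g_of_real[OF mu])
    hence ne: "a \<noteq> x" if "a \<in> A" for a using that by auto
    have "((\<lambda>z. bessel_f \<mu> z / bessel_g \<mu> z - (\<Sum>a\<in>A. of_real (resid \<mu> a) / (of_real a - z)) - of_real c)
      has_field_derivative of_real (1 / (2 * \<mu>\<^sup>2)) - (\<Sum>a\<in>A. of_real (resid \<mu> a) / (of_real a - of_real x) ^ 2) - 0)
      (at (complex_of_real x))"
      by (intro DERIV_diff DERIV_sum dq DERIV_const)
         (use \<open>x \<notin> A\<close> in \<open>auto intro!: derivative_eq_intros simp: ne power2_eq_square\<close>)
    moreover have "eventually (\<lambda>z. H z - of_real c = bessel_f \<mu> z / bessel_g \<mu> z - (\<Sum>a\<in>A. of_real (resid \<mu> a) / (of_real a - z)) - of_real c)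
       (nhds (complex_of_real x))"
    proof -
      have "isCont (bessel_g \<mu>) (complex_of_real x)"
        by (rule DERIV_isCont[OF bessel_g_has_field_derivative[OF mu]])
      hence "eventually (\<lambda>z. bessel_g \<mu> z \<noteq> 0) (nhds (complex_of_real x))"
        using dq(1) unfolding isCont_def tendsto_at_iff_tendsto_nhds by (rule tendsto_imp_eventually_ne)
      moreover have "eventually (\<lambda>z. z \<in> ball 0 r) (nhds (complex_of_real x))"
        using r x(1) by (intro eventually_nhds_in_open) auto
      ultimately show ?thesis by eventually_elim (simp add: Heq)
    qed
    ultimately show "((\<lambda>z. H z - of_real c) has_field_derivative
        of_real (1 / (2 * \<mu>\<^sup>2) - (\<Sum>a\<in>A. resid \<mu> a / (a - x) ^ 2))) (at (complex_of_real x))"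
      by (subst DERIV_cong_ev[OF refl _ refl]) simp_all
  qed
  ultimately have "norm (complex_of_real (1 / (2 * \<mu>\<^sup>2) - (\<Sum>a\<in>A. resid \<mu> a / (a - x) ^ 2))) \<le> B"
    by simp
  thus ?thesis unfolding norm_of_real A_def B_def .
qed

section \<open>Positive zeros\<close>

text \<open>
  If \<open>f (x\<^sup>2)\<close> has no zero, then \<open>v = J\<^sub>\<mu>' / J\<^sub>\<mu>\<close> satisfies the Riccati equation
  \<open>v' = - (1 + v\<^sup>2) + \<mu>\<^sup>2 / x\<^sup>2 - v / x\<close>. For large \<open>x\<close> the derivative of \<open>arctan v\<close> is at most \<open>- 1/2\<close>,
  so on an interval of length \<open>9 > 2 pi\<close> it would drop by more than \<open>pi\<close>.
\<close>
lemma bessel_f_zero_exists: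
  assumes mu: "\<mu> > 0" and X: "X \<ge> 2" "X \<ge> 2 * \<mu>"
  shows "\<exists>x\<in>{X..X+9}. bessel_f \<mu> (x ^ 2) = (0 :: real)"
proof (rule ccontr)
  assume "\<not> ?thesis"
  hence F0: "bessel_f \<mu> (x ^ 2) \<noteq> 0" if "X \<le> x" "x \<le> X + 9" for x :: real
    using that by auto
  define v where "v = (\<lambda>x. bessel_g \<mu> (x ^ 2) / (x * bessel_f \<mu> (x ^ 2)) :: real)"
  have der: "\<exists>d. ((\<lambda>x. arctan (v x)) has_real_derivative d) (at x) \<and> d \<le> - (1 / 2)"
    if x: "X \<le> x" "x \<le> X + 9" for x
  proof -
    define F where "F = bessel_f \<mu> (x ^ 2)"
    define G where "G = bessel_g \<mu> (x ^ 2)"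
    have F: "F \<noteq> 0" using F0[OF x] by (simp add: F_def)
    have x0: "x \<ge> 2" "x \<ge> 2 * \<mu>" using X x by auto
    have fd: "((\<lambda>x. bessel_f \<mu> (x ^ 2)) has_real_derivative (G - \<mu> * F) / x) (at x)"
    proof -
      have "((\<lambda>x. bessel_f \<mu> (x ^ 2)) has_real_derivative bessel_f' \<mu> (x ^ 2) * (2 * x)) (at x)"
        by (rule DERIV_chain2[where g = "\<lambda>x. x ^ 2", OF bessel_f_has_field_derivative[OF mu]])
           (auto intro!: derivative_eq_intros)
      also have "bessel_f' \<mu> (x ^ 2) * (2 * x) = (G - \<mu> * F) / x"
        using bessel_f_deriv_eq[of "x ^ 2" \<mu>] x0 by (simp add: F_def G_def field_simps power2_eq_square)
      finally show ?thesis .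
    qed
    have gd: "((\<lambda>x. bessel_g \<mu> (x ^ 2)) has_real_derivative ((\<mu>\<^sup>2 - x\<^sup>2) * F - \<mu> * G) / x) (at x)"
    proof -
      have "((\<lambda>x. bessel_g \<mu> (x ^ 2)) has_real_derivative bessel_g' \<mu> (x ^ 2) * (2 * x)) (at x)"
        by (rule DERIV_chain2[where g = "\<lambda>x. x ^ 2", OF bessel_g_has_field_derivative[OF mu]])
           (auto intro!: derivative_eq_intros)
      also have "bessel_g' \<mu> (x ^ 2) * (2 * x) = ((\<mu>\<^sup>2 - x\<^sup>2) * F - \<mu> * G) / x"
        using bessel_g_deriv_eq[OF mu, of "x ^ 2"] x0 by (simp add: F_def G_def field_simps power2_eq_square)
      finally show ?thesis .
    qed
    define N where "N = (\<mu>\<^sup>2 - x\<^sup>2) * F ^ 2 - G * F - G ^ 2"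
    have vd: "(v has_real_derivative N / (x ^ 2 * F ^ 2)) (at x)"
    proof -
      have "((\<lambda>x. x * bessel_f \<mu> (x ^ 2)) has_real_derivative F + (G - \<mu> * F)) (at x)"
        using DERIV_mult[OF DERIV_ident fd] x0 by (simp add: F_def)
      from DERIV_divide[OF gd this]
      have "(v has_real_derivative (((\<mu>\<^sup>2 - x\<^sup>2) * F - \<mu> * G) / x * (x * F) - G * (F + (G - \<mu> * F))) / (x * F * (x * F))) (at x)"
        using F x0 by (simp add: v_def F_def G_def)
      also have "((\<mu>\<^sup>2 - x\<^sup>2) * F - \<mu> * G) / x * (x * F) - G * (F + (G - \<mu> * F)) = N"
      proof -
        have "Z / x * (x * F) = Z * F" for Z using x0 by simp
        thus ?thesis by (simp only: N_def) (simp add: power2_eq_square algebra_simps)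
      qed
      finally show ?thesis by (simp add: power2_eq_square mult_ac)
    qed
    have "((\<lambda>x. arctan (v x)) has_real_derivative (N / (x ^ 2 * F ^ 2)) / (1 + (v x) ^ 2)) (at x)"
      using DERIV_chain2[OF DERIV_arctan vd] by (simp add: field_simps)
    also have "(N / (x ^ 2 * F ^ 2)) / (1 + (v x) ^ 2) = N / (x ^ 2 * F ^ 2 + G ^ 2)"
    proof -
      have "1 + (v x) ^ 2 = (x ^ 2 * F ^ 2 + G ^ 2) / (x ^ 2 * F ^ 2)"
        using F x0 by (simp add: v_def F_def G_def power_mult_distrib power_divide add_divide_distrib)
      thus ?thesis using F x0 by simp
    qed
    finally have "((\<lambda>x. arctan (v x)) has_real_derivative N / (x ^ 2 * F ^ 2 + G ^ 2)) (at x)" .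
    moreover have "N / (x ^ 2 * F ^ 2 + G ^ 2) \<le> - (1 / 2)"
    proof -
      have "x ^ 2 * F ^ 2 + G ^ 2 > 0" using F x0 by (intro add_pos_nonneg) auto
      moreover have "2 * N + (x ^ 2 * F ^ 2 + G ^ 2) \<le> 0"
      proof -
        have "4 * \<mu>\<^sup>2 \<le> x\<^sup>2" "4 \<le> x\<^sup>2"
          using power_mono[OF x0(2), of 2] power_mono[OF x0(1), of 2] mu by (simp_all add: power_mult_distrib)
        hence "(2 * \<mu>\<^sup>2 - x\<^sup>2) * F ^ 2 \<le> (- 2) * F ^ 2"
          by (intro mult_right_mono) auto
        moreover have "2 * N + (x ^ 2 * F ^ 2 + G ^ 2) = (2 * \<mu>\<^sup>2 - x\<^sup>2) * F ^ 2 + 2 * F ^ 2 - ((F + G) ^ 2 + F ^ 2)"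
          by (simp add: N_def power2_eq_square algebra_simps)
        ultimately show ?thesis using zero_le_power2[of "F + G"] zero_le_power2[of F] by linarith
      qed
      moreover have "N / W \<le> - (1 / 2)" if "W > 0" "2 * N + W \<le> 0" for W
        using that by (simp add: pos_divide_le_eq)
      ultimately show ?thesis by blast
    qed
    ultimately show ?thesis by blast
  qed
  then obtain d where d: "\<And>x. X \<le> x \<Longrightarrow> x \<le> X + 9 \<Longrightarrow>
      ((\<lambda>x. arctan (v x)) has_real_derivative d x) (at x) \<and> d x \<le> - (1 / 2)"
    by metis
  obtain \<xi> where \<xi>: "X < \<xi>" "\<xi> < X + 9" "arctan (v (X + 9)) - arctan (v X) = (X + 9 - X) * d \<xi>"
    using MVT2[of X "X + 9" "\<lambda>x. arctan (v x)" d] d by auto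
  have "d \<xi> \<le> - (1 / 2)" using d[of \<xi>] \<xi> by simp
  hence "arctan (v (X + 9)) - arctan (v X) \<le> - (9 / 2)" using \<xi>(3) by simp
  moreover have "arctan (v (X + 9)) > - pi / 2" "arctan (v X) < pi / 2"
    using arctan_lbound[of "v (X + 9)"] arctan_ubound by auto
  ultimately show False using pi_less_4 by simp
qed

text \<open>
  Rolle's theorem for \<open>x\<^sup>c f (x\<^sup>2)\<close>, whose derivative is \<open>x\<^sup>c\<^sup>-\<^sup>1 (g + (c - \<mu>) f) (x\<^sup>2)\<close>. The choice \<open>c = \<mu>\<close>
  gives the zeros of \<open>J\<^sub>\<mu>'\<close>, and \<open>c = 2 \<mu>\<close>, the identity \<open>(x\<^sup>\<mu> J\<^sub>\<mu>)' = x\<^sup>\<mu> J\<^sub>\<mu>\<^sub>-\<^sub>1\<close>, those of \<open>J\<^sub>\<nu>\<close>.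
\<close>
lemma unbounded_zeros:
  assumes mu: "\<mu> > 0"
  shows "\<exists>x>X. bessel_g \<mu> (x ^ 2) + (c - \<mu>) * bessel_f \<mu> (x ^ 2) = (0 :: real)"
proof -
  define Y where "Y = max X (max 2 (2 * \<mu>))"
  have Y: "Y \<ge> 2" "Y \<ge> 2 * \<mu>" "Y \<ge> X" by (auto simp: Y_def)
  obtain p where p: "Y \<le> p" "p \<le> Y + 9" "bessel_f \<mu> (p ^ 2) = (0 :: real)"
    using bessel_f_zero_exists[OF mu Y(1,2)] by auto
  obtain q where q: "Y + 10 \<le> q" "bessel_f \<mu> (q ^ 2) = (0 :: real)"
    using bessel_f_zero_exists[OF mu, of "Y + 10"] Y by auto
  have der: "((\<lambda>x. x powr c * bessel_f \<mu> (x ^ 2)) has_real_derivative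
      x powr (c - 1) * (bessel_g \<mu> (x ^ 2) + (c - \<mu>) * bessel_f \<mu> (x ^ 2))) (at x)" if x: "x > 0" for x
  proof -
    have "((\<lambda>x. bessel_f \<mu> (x ^ 2)) has_real_derivative bessel_f' \<mu> (x ^ 2) * (2 * x)) (at x)"
      by (rule DERIV_chain2[where g = "\<lambda>x. x ^ 2", OF bessel_f_has_field_derivative[OF mu]])
         (auto intro!: derivative_eq_intros)
    from DERIV_mult[OF has_real_derivative_powr[OF x, of c] this]
    have "((\<lambda>x. x powr c * bessel_f \<mu> (x ^ 2)) has_real_derivative
       c * x powr (c - 1) * bessel_f \<mu> (x ^ 2) + bessel_f' \<mu> (x ^ 2) * (2 * x) * x powr c) (at x)" .
    also have "bessel_f' \<mu> (x ^ 2) * (2 * x) * x powr c = x powr (c - 1) * (2 * x ^ 2 * bessel_f' \<mu> (x ^ 2))"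
      using x by (simp add: powr_diff power2_eq_square)
    also have "c * x powr (c - 1) * bessel_f \<mu> (x ^ 2) + x powr (c - 1) * (2 * x ^ 2 * bessel_f' \<mu> (x ^ 2)) =
       x powr (c - 1) * (bessel_g \<mu> (x ^ 2) + (c - \<mu>) * bessel_f \<mu> (x ^ 2))"
      by (simp only: bessel_f_deriv_eq) (simp add: algebra_simps)
    finally show ?thesis .
  qed
  have pq: "0 < p" "p < q" using p q Y by auto
  obtain x where x: "p < x" "x < q" "q powr c * bessel_f \<mu> (q ^ 2) - p powr c * bessel_f \<mu> (p ^ 2)
      = (q - p) * (x powr (c - 1) * (bessel_g \<mu> (x ^ 2) + (c - \<mu>) * bessel_f \<mu> (x ^ 2)))"
    using MVT2[OF pq(2) der] pq(1) by auto
  hence "bessel_g \<mu> (x ^ 2) + (c - \<mu>) * bessel_f \<mu> (x ^ 2) = 0"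
    using p q pq by simp
  thus ?thesis using x(1) p(1) Y by (intro exI[of _ x]) auto
qed

lemma enumerate_discrete:
  fixes S :: "real set"
  assumes fin: "\<And>X. finite {y \<in> S. y \<le> X}" and unb: "\<And>X. \<exists>x\<in>S. x > X"
  obtains s where "strict_mono_on {1..} s" "s ` {1..} = S" "filterlim (\<lambda>n. s (Suc n)) at_top sequentially"
proof -
  \<comment> \<open>the rank function, which is inverted step by step\<close>
  define c where "c = (\<lambda>x. card {y \<in> S. y \<le> x})"
  have next_elem: "\<exists>y\<in>S. x < y \<and> c y = Suc (c x)" for x
  proof -
    obtain x' where x': "x' \<in> S" "x' > x" using unb by blast
    define T where "T = {y \<in> S. x < y \<and> y \<le> x'}"
    have T: "finite T" "T \<noteq> {}" using x' by (auto simp: T_def intro: finite_subset[OF _ fin[of x']])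
    define y where "y = Min T"
    have y: "y \<in> S" "x < y" "y \<le> x'" using Min_in[OF T] by (auto simp: y_def T_def)
    have "{z \<in> S. z \<le> y} = insert y {z \<in> S. z \<le> x}"
    proof (intro equalityI subsetI)
      fix z assume z: "z \<in> {z \<in> S. z \<le> y}"
      show "z \<in> insert y {z \<in> S. z \<le> x}"
      proof (cases "z \<le> x")
        case False
        hence "z \<in> T" using z y by (auto simp: T_def)
        hence "y \<le> z" using T by (simp add: y_def)
        thus ?thesis using z by auto
      qed (use z in auto)
    qed (use y in auto)
    hence "c y = Suc (c x)" using y by (simp add: c_def fin)
    thus ?thesis using y by blast
  qed
  have c_less: "c x < c y" if "x < y" "y \<in> S" for x y
    unfolding c_def using that by (intro psubset_card_mono fin) force
  have "\<exists>x. x \<in> S \<and> c x = Suc 0"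
  proof -
    obtain x0 where x0: "x0 \<in> S" using unb by blast
    define T where "T = {y \<in> S. y \<le> x0}"
    have T: "finite T" "T \<noteq> {}" using x0 by (auto simp: T_def fin)
    have m: "Min T \<in> S" "Min T \<le> x0" using Min_in[OF T] by (auto simp: T_def)
    have "{z \<in> S. z \<le> Min T} = {Min T}"
    proof (intro equalityI subsetI)
      fix z assume z: "z \<in> {z \<in> S. z \<le> Min T}"
      hence "z \<in> T" using m by (auto simp: T_def)
      hence "Min T \<le> z" using T by simp
      thus "z \<in> {Min T}" using z by auto
    qed (use m in auto)
    thus ?thesis using m by (auto simp: c_def)
  qed
  moreover have "\<exists>y. (y \<in> S \<and> c y = Suc (Suc n)) \<and> x < y" if "x \<in> S \<and> c x = Suc n" for x n
    using next_elem[of x] that by auto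
  ultimately obtain t where t: "\<And>n. t n \<in> S \<and> c (t n) = Suc n" "\<And>n. t n < t (Suc n)"
    using dependent_nat_choice[of "\<lambda>n x. x \<in> S \<and> c x = Suc n" "\<lambda>n x y. x < y"] by metis
  have mono: "strict_mono t" by (simp add: strict_mono_Suc_iff t)
  have surj: "\<exists>n. x = t n" if x: "x \<in> S" for x
  proof -
    have "c x > 0" unfolding c_def using x by (auto simp: card_gt_0_iff fin)
    then obtain n where n: "c x = Suc n" by (cases "c x") auto
    have "x = t n" using c_less[of x "t n"] c_less[of "t n" x] t(1)[of n] x n by force
    thus ?thesis ..
  qed
  show ?thesis
  proof (rule that[of "\<lambda>k. t (k - 1)"])
    show "strict_mono_on {1..} (\<lambda>k. t (k - 1))"
      using mono by (auto simp: strict_mono_on_def strict_mono_def)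
    show "(\<lambda>k. t (k - 1)) ` {1..} = S"
    proof (intro equalityI subsetI)
      fix x assume "x \<in> S"
      then obtain n where "x = t n" using surj by blast
      thus "x \<in> (\<lambda>k. t (k - 1)) ` {1..}" by (intro image_eqI[of _ _ "Suc n"]) auto
    qed (use t in auto)
    show "filterlim (\<lambda>n. t (Suc n - 1)) at_top sequentially"
      unfolding filterlim_at_top
    proof
      fix Z
      obtain x where x: "x \<in> S" "x > Z" using unb by blast
      then obtain k where k: "x = t k" using surj by blast
      have "Z \<le> t n" if "n \<ge> k" for n
        using strict_mono_leD[OF mono that] x k by simp
      thus "eventually (\<lambda>n. Z \<le> t (Suc n - 1)) sequentially"
        by (auto simp: eventually_sequentially)
    qed
  qed
qed

lemma bessel_J_eq:
  assumes mu: "\<mu> > 0" and x: "x > 0"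
  shows "bessel_J \<mu> x = (x / 2) powr \<mu> * bessel_f \<mu> (x ^ 2)"
proof -
  have "(- 1) ^ m / (fact m * Gamma (real m + \<mu> + 1)) * (x / 2) powr (2 * real m + \<mu>)
      = (x / 2) powr \<mu> * (bcoef \<mu> m * (x ^ 2) ^ m)" for m
  proof -
    have "(x / 2) powr (2 * real m + \<mu>) = (x / 2) powr \<mu> * (x / 2) ^ (2 * m)"
      using x powr_realpow[of "x / 2" "2 * m"] by (simp add: powr_add)
    also have "(x / 2) ^ (2 * m) = (x ^ 2) ^ m / 4 ^ m"
      by (simp add: power_mult power_divide)
    finally show ?thesis by (simp add: bcoef_def mult_ac)
  qed
  thus ?thesis unfolding bessel_J_def bessel_f_def
    using suminf_mult[OF summable_bcoef[OF mu, of "x ^ 2"]] by simp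
qed

lemma bessel_J_minus_one_eq:
  assumes mu: "\<mu> > 0" and x: "x > 0"
  shows "bessel_J (\<mu> - 1) x = (x / 2) powr (\<mu> - 1) * ((bessel_g \<mu> (x ^ 2) + \<mu> * bessel_f \<mu> (x ^ 2)) / 2)"
proof -
  have "(\<lambda>m. of_nat m * bcoef \<mu> m * (x ^ 2) ^ (m - 1)) sums bessel_f' \<mu> (x ^ 2)"
    using diffs_equiv[of "bcoef \<mu>" "x ^ 2"] summable_diffs_bcoef[OF mu, of "x ^ 2"]
    by (simp add: bessel_f'_def)
  from sums_mult[OF this, of "x ^ 2"]
  have "(\<lambda>m. real m * bcoef \<mu> m * (x ^ 2) ^ m) sums (x ^ 2 * bessel_f' \<mu> (x ^ 2))"
    by (rule back_subst[where P="\<lambda>f. f sums _"]) (auto simp: fun_eq_iff power_eq_if)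
  moreover have "(\<lambda>m. \<mu> * (bcoef \<mu> m * (x ^ 2) ^ m)) sums (\<mu> * bessel_f \<mu> (x ^ 2))"
    using summable_sums[OF summable_bcoef[OF mu, of "x ^ 2"]]
    by (intro sums_mult) (simp add: bessel_f_def)
  ultimately have "(\<lambda>m. real m * bcoef \<mu> m * (x ^ 2) ^ m + \<mu> * (bcoef \<mu> m * (x ^ 2) ^ m)) sums
      (x ^ 2 * bessel_f' \<mu> (x ^ 2) + \<mu> * bessel_f \<mu> (x ^ 2))" by (rule sums_add)
  also have "x ^ 2 * bessel_f' \<mu> (x ^ 2) + \<mu> * bessel_f \<mu> (x ^ 2) = (bessel_g \<mu> (x ^ 2) + \<mu> * bessel_f \<mu> (x ^ 2)) / 2"
    by (simp add: bessel_g_def)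
  finally have sums: "(\<lambda>m. (x / 2) powr (\<mu> - 1) * (real m * bcoef \<mu> m * (x ^ 2) ^ m + \<mu> * (bcoef \<mu> m * (x ^ 2) ^ m))) sums
     ((x / 2) powr (\<mu> - 1) * ((bessel_g \<mu> (x ^ 2) + \<mu> * bessel_f \<mu> (x ^ 2)) / 2))"
    by (rule sums_mult)
  have "(x / 2) powr (\<mu> - 1) * (real m * bcoef \<mu> m * (x ^ 2) ^ m + \<mu> * (bcoef \<mu> m * (x ^ 2) ^ m)) =
    (- 1) ^ m / (fact m * Gamma (real m + (\<mu> - 1) + 1)) * (x / 2) powr (2 * real m + (\<mu> - 1))" for m
  proof -
    have "(x / 2) powr (2 * real m + (\<mu> - 1)) = (x / 2) powr (\<mu> - 1) * (x / 2) ^ (2 * m)"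
      using x powr_realpow[of "x / 2" "2 * m"] by (simp only: powr_add) simp
    also have "(x / 2) ^ (2 * m) = (x ^ 2) ^ m / 4 ^ m"
      by (simp add: power_mult power_divide)
    finally have 1: "(x / 2) powr (2 * real m + (\<mu> - 1)) = (x / 2) powr (\<mu> - 1) * ((x ^ 2) ^ m / 4 ^ m)" .
    have "Gamma (real m + \<mu> + 1) = (real m + \<mu>) * Gamma (real m + \<mu>)"
      using mu by (intro Gamma_plus1) (auto simp: nonpos_Ints_def)
    moreover have "Gamma (real m + \<mu>) > 0" "real m + \<mu> > 0" using mu by (auto intro!: Gamma_real_pos add_nonneg_pos)
    ultimately have 2: "(real m + \<mu>) * bcoef \<mu> m = (- 1) ^ m / (4 ^ m * fact m * Gamma (real m + \<mu>))"
      by (simp add: bcoef_def)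
    have "real m * bcoef \<mu> m * (x ^ 2) ^ m + \<mu> * (bcoef \<mu> m * (x ^ 2) ^ m) = ((real m + \<mu>) * bcoef \<mu> m) * (x ^ 2) ^ m"
      by (simp add: algebra_simps)
    thus ?thesis unfolding 1 2 by (simp add: mult_ac)
  qed
  with sums show ?thesis unfolding bessel_J_def by (simp add: sums_iff)
qed

lemma deriv_bessel_J:
  assumes mu: "\<mu> > 0" and x: "x > 0"
  shows "deriv (bessel_J \<mu>) x = (x / 2) powr \<mu> * bessel_g \<mu> (x ^ 2) / x"
proof (rule DERIV_imp_deriv)
  have "((\<lambda>x. bessel_f \<mu> (x ^ 2)) has_real_derivative bessel_f' \<mu> (x ^ 2) * (2 * x)) (at x)"
    by (rule DERIV_chain2[where g = "\<lambda>x. x ^ 2", OF bessel_f_has_field_derivative[OF mu]])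
       (auto intro!: derivative_eq_intros)
  moreover have "((\<lambda>x. (x / 2) powr \<mu>) has_real_derivative \<mu> * (x / 2) powr \<mu> / x) (at x)"
  proof -
    have "((\<lambda>x. (x / 2) powr \<mu>) has_real_derivative \<mu> * (x / 2) powr (\<mu> - 1) * (1 / 2)) (at x)"
      by (rule DERIV_chain2[where g = "\<lambda>x. x / 2", OF has_real_derivative_powr])
         (use x in \<open>auto intro!: derivative_eq_intros\<close>)
    thus ?thesis using x by (simp add: powr_diff)
  qed
  ultimately have "((\<lambda>x. (x / 2) powr \<mu> * bessel_f \<mu> (x ^ 2)) has_real_derivative
     \<mu> * (x / 2) powr \<mu> / x * bessel_f \<mu> (x ^ 2) + bessel_f' \<mu> (x ^ 2) * (2 * x) * (x / 2) powr \<mu>) (at x)"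
    by (rule DERIV_mult[rotated])
  also have "\<mu> * (x / 2) powr \<mu> / x * bessel_f \<mu> (x ^ 2) + bessel_f' \<mu> (x ^ 2) * (2 * x) * (x / 2) powr \<mu>
     = (x / 2) powr \<mu> * bessel_g \<mu> (x ^ 2) / x"
    using x by (simp add: bessel_g_def field_simps power2_eq_square)
  finally have D: "((\<lambda>x. (x / 2) powr \<mu> * bessel_f \<mu> (x ^ 2)) has_real_derivative
     (x / 2) powr \<mu> * bessel_g \<mu> (x ^ 2) / x) (at x)" .
  have "eventually (\<lambda>y. y > 0) (nhds x)" using x eventually_nhds_in_open[of "{0<..}" x] by simp
  hence "eventually (\<lambda>y. bessel_J \<mu> y = (y / 2) powr \<mu> * bessel_f \<mu> (y ^ 2)) (nhds x)"
    by eventually_elim (rule bessel_J_eq[OF mu])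
  from DERIV_cong_ev[OF refl this refl] D
  show "(bessel_J \<mu> has_real_derivative (x / 2) powr \<mu> * bessel_g \<mu> (x ^ 2) / x) (at x)" by blast
qed

lemma finite_bounded_zeros:
  assumes mu: "\<mu> > 0" and c: "c \<noteq> 0"
  shows "finite {y \<in> {y. 0 < y \<and> bessel_g \<mu> (y ^ 2) + (c - \<mu>) * bessel_f \<mu> (y ^ 2) = 0}. y \<le> (X::real)}" (is "finite ?A")
proof (rule inj_on_finite[where f = "\<lambda>y. complex_of_real (y ^ 2)"])
  show "inj_on (\<lambda>y. complex_of_real (y ^ 2)) ?A"
    by (auto simp: inj_on_def power2_eq_iff_nonneg simp del: of_real_power)
  let ?e = "\<lambda>z::complex. bessel_g \<mu> z + of_real (c - \<mu>) * bessel_f \<mu> z"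
  show "(\<lambda>y. complex_of_real (y ^ 2)) ` ?A \<subseteq> {z. norm z \<le> X ^ 2 \<and> ?e z = 0}"
  proof safe
    fix y :: real assume y: "y > 0" "y \<le> X" "bessel_g \<mu> (y ^ 2) + (c - \<mu>) * bessel_f \<mu> (y ^ 2) = 0"
    show "norm (complex_of_real (y ^ 2)) \<le> X ^ 2"
      using y by (simp add: norm_power power_mono)
    have "?e (complex_of_real (y ^ 2)) = of_real (bessel_g \<mu> (y ^ 2) + (c - \<mu>) * bessel_f \<mu> (y ^ 2))"
      by (simp only: bessel_f_of_real[OF mu] bessel_g_of_real[OF mu] of_real_add of_real_mult)
    thus "?e (complex_of_real (y ^ 2)) = 0" by (simp only: y(3) of_real_0)
  qed
  have "?e 0 = of_real (c * bcoef \<mu> 0)"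
    by (simp add: bessel_f_0 bessel_g_0 algebra_simps)
  hence "?e 0 \<noteq> 0" using c bcoef_0[OF mu] by simp
  thus "finite {z. norm z \<le> X ^ 2 \<and> ?e z = 0}"
    by (intro finite_zeros_of_entire holomorphic_intros bessel_fg_holomorphic mu)
qed

lemma zero_enumeration:
  assumes mu: "\<mu> > 0" and c: "c \<noteq> 0"
    and J: "\<And>x. x > 0 \<Longrightarrow> J x = 0 \<longleftrightarrow> bessel_g \<mu> (x ^ 2) + (c - \<mu>) * bessel_f \<mu> (x ^ 2) = 0"
  shows "strict_mono_on {1..} (pos_zero J)" "pos_zero J ` {1..} = {x. 0 < x \<and> J x = 0}"
    "filterlim (\<lambda>n. pos_zero J (Suc n)) at_top sequentially"
proof -
  have eq: "{x. 0 < x \<and> J x = 0} = {x. 0 < x \<and> bessel_g \<mu> (x ^ 2) + (c - \<mu>) * bessel_f \<mu> (x ^ 2) = 0}"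
    using J by auto
  have fin: "finite {y \<in> {x. 0 < x \<and> J x = 0}. y \<le> X}" for X
    unfolding eq by (rule finite_bounded_zeros[OF mu c])
  have unb: "\<exists>x\<in>{x. 0 < x \<and> J x = 0}. x > X" for X
    using unbounded_zeros[OF mu, of "max 0 X" c] unfolding eq by auto
  obtain s where s: "strict_mono_on {1..} s" "s ` {1..} = {x. 0 < x \<and> J x = 0}"
     "filterlim (\<lambda>n. s (Suc n)) at_top sequentially"
    by (rule enumerate_discrete[OF fin unb])
  have p: "pos_zero J n = s n" if "n \<ge> 1" for n
    using pos_zero_eqI[OF s(1,2) that] .
  show "strict_mono_on {1..} (pos_zero J)"
    using s(1) p by (auto simp: strict_mono_on_def)
  show "pos_zero J ` {1..} = {x. 0 < x \<and> J x = 0}"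
    using s(2) p by (auto simp: image_iff)
  show "filterlim (\<lambda>n. pos_zero J (Suc n)) at_top sequentially"
    using s(3) p by simp
qed

theorem mainTheorem17:
  fixes \<nu> :: real and n :: nat
  assumes "\<nu> > -1" and "n \<ge> 1"
  shows "(\<lambda>i. let k = i + 1 in
           (bessel_deriv_zero (\<nu> + 1) k)\<^sup>2 /
             (((bessel_deriv_zero (\<nu> + 1) k)\<^sup>2 - (\<nu> + 1)\<^sup>2) *
              ((bessel_zero \<nu> n)\<^sup>2 - (bessel_deriv_zero (\<nu> + 1) k)\<^sup>2)\<^sup>2))
         sums (1 / (4 * (\<nu> + 1)\<^sup>2))"
proof -
  define \<mu> where "\<mu> = \<nu> + 1"
  have mu: "\<mu> > 0" and nu: "\<nu> = \<mu> - 1" using assms by (auto simp: \<mu>_def)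
  define s where "s = bessel_deriv_zero \<mu>"
  have J': "deriv (bessel_J \<mu>) x = 0 \<longleftrightarrow> bessel_g \<mu> (x ^ 2) + (\<mu> - \<mu>) * bessel_f \<mu> (x ^ 2) = 0" if "x > 0" for x
    using deriv_bessel_J[OF mu that] that by simp
  have J: "bessel_J \<nu> x = 0 \<longleftrightarrow> bessel_g \<mu> (x ^ 2) + (2 * \<mu> - \<mu>) * bessel_f \<mu> (x ^ 2) = 0" if "x > 0" for x
    unfolding nu bessel_J_minus_one_eq[OF mu that] using that by simp
  note s = zero_enumeration[OF mu _ J', folded bessel_deriv_zero_def s_def]
  have s_mono: "strict_mono_on {1..} s" and s_range: "s ` {1..} = {x. 0 < x \<and> deriv (bessel_J \<mu>) x = 0}"
    and s_lim: "filterlim (\<lambda>n. s (Suc n)) at_top sequentially"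
    using s mu by auto
  have s_pos: "s k > 0" if "k \<ge> 1" for k using s_range that by auto
  have s_less_eq: "s i \<le> s j \<longleftrightarrow> i \<le> j" if "i \<ge> 1" "j \<ge> 1" for i j
    using strict_mono_on_less_eq[OF s_mono] that by auto

  define y where "y = bessel_zero \<nu> n"
  have "y \<in> {x. 0 < x \<and> bessel_J \<nu> x = 0}"
    using zero_enumeration(2)[OF mu _ J] mu assms(2) by (auto simp: y_def bessel_zero_def)
  hence y: "y\<^sup>2 > 0" "bessel_g \<mu> (y\<^sup>2) = - \<mu> * bessel_f \<mu> (y\<^sup>2)"
    using J[of y] by auto

  define T where "T = (\<lambda>k. (s k)\<^sup>2 / (((s k)\<^sup>2 - \<mu>\<^sup>2) * (y\<^sup>2 - (s k)\<^sup>2)\<^sup>2))"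
  \<comment> \<open>with this radius the disc contains exactly the first \<open>N\<close> poles\<close>
  have zeros: "zeros_upto \<mu> ((s N)\<^sup>2) = (\<lambda>k. (s k)\<^sup>2) ` {1..N}" if N: "N \<ge> 1" for N
  proof (intro equalityI subsetI)
    fix a assume a: "a \<in> zeros_upto \<mu> ((s N)\<^sup>2)"
    have a0: "a > 0" by (rule zeros_upto_pos[OF mu a])
    have "sqrt a \<in> {x. 0 < x \<and> deriv (bessel_J \<mu>) x = 0}"
      using a a0 J'[of "sqrt a"] by (simp add: zeros_upto_def)
    then obtain k where k: "k \<ge> 1" "sqrt a = s k" unfolding s_range[symmetric] by auto
    have "s k \<le> s N" using a s_pos[OF N] unfolding k(2)[symmetric]
      by (simp add: zeros_upto_def real_sqrt_le_iff' real_le_lsqrt)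
    hence "k \<in> {1..N}" using k N s_less_eq by simp
    moreover have "a = (s k)\<^sup>2" using a0 by (simp flip: k(2))
    ultimately show "a \<in> (\<lambda>k. (s k)\<^sup>2) ` {1..N}" by blast
  next
    fix a assume "a \<in> (\<lambda>k. (s k)\<^sup>2) ` {1..N}"
    then obtain k where k: "k \<ge> 1" "k \<le> N" "a = (s k)\<^sup>2" by auto
    have "s k \<in> {x. 0 < x \<and> deriv (bessel_J \<mu>) x = 0}" unfolding s_range[symmetric] using k by auto
    hence "bessel_g \<mu> a = 0" using J'[of "s k"] by (simp add: k)
    moreover have "a \<le> (s N)\<^sup>2" using k s_less_eq[of k N] s_pos[of k] by (simp add: power_mono)
    ultimately show "a \<in> zeros_upto \<mu> ((s N)\<^sup>2)" by (simp add: zeros_upto_def)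
  qed
  have partial: "(\<Sum>a\<in>zeros_upto \<mu> ((s N)\<^sup>2). resid \<mu> a / (a - y\<^sup>2)\<^sup>2) = 2 * (\<Sum>i<N. T (i + 1))" if N: "N \<ge> 1" for N
  proof -
    have inj: "inj_on (\<lambda>k. (s k)\<^sup>2) {1..N}"
    proof (rule inj_onI)
      fix i j assume ij: "i \<in> {1..N}" "j \<in> {1..N}" "(s i)\<^sup>2 = (s j)\<^sup>2"
      hence "s i = s j" using s_pos[of i] s_pos[of j] by (auto simp: power2_eq_iff_nonneg)
      thus "i = j" using s_less_eq[of i j] s_less_eq[of j i] ij by auto
    qed
    have "(\<Sum>a\<in>zeros_upto \<mu> ((s N)\<^sup>2). resid \<mu> a / (a - y\<^sup>2)\<^sup>2)
       = (\<Sum>k\<in>{1..N}. resid \<mu> ((s k)\<^sup>2) / ((s k)\<^sup>2 - y\<^sup>2)\<^sup>2)"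
      unfolding zeros[OF N] sum.reindex[OF inj] by simp
    also have "\<dots> = (\<Sum>k\<in>{1..N}. 2 * T k)"
      by (simp add: T_def resid_def power2_commute)
    also have "\<dots> = 2 * (\<Sum>k\<in>{1..N}. T k)" by (simp add: sum_distrib_left)
    also have "(\<Sum>k\<in>{1..N}. T k) = (\<Sum>i<N. T (i + 1))"
      by (rule sum.reindex_bij_witness[of _ "\<lambda>i. i + 1" "\<lambda>k. k - 1"]) auto
    finally show ?thesis .
  qed
  have s2_lim: "filterlim (\<lambda>N. (s (Suc N))\<^sup>2) at_top sequentially"
    using filterlim_pow_at_top[OF _ s_lim, of 2] by simp
  have "(\<lambda>N. \<Sum>i<Suc N. T (i + 1)) \<longlonglongrightarrow> 1 / (4 * \<mu>\<^sup>2)"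
  proof (rule LIM_zero_cancel, rule Lim_null_comparison)
    show "eventually (\<lambda>N. norm ((\<Sum>i<Suc N. T (i + 1)) - 1 / (4 * \<mu>\<^sup>2)) \<le> 3 * (y\<^sup>2 + 2) / \<mu> / (s (Suc N))\<^sup>2) sequentially"
      using s2_lim unfolding filterlim_at_top
    proof (elim allE[of _ "2 * (y\<^sup>2 + 2)"] eventually_mono)
      fix N assume "2 * (y\<^sup>2 + 2) \<le> (s (Suc N))\<^sup>2"
      from partial_sum_bound[OF mu y this]
      have "\<bar>1 / (2 * \<mu>\<^sup>2) - 2 * (\<Sum>i<Suc N. T (i + 1))\<bar> \<le> 2 * (3 * (y\<^sup>2 + 2) / \<mu> / (s (Suc N))\<^sup>2)"
        by (simp only: partial) (simp add: mult_ac)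
      moreover have "1 / (2 * \<mu>\<^sup>2) = 2 * (1 / (4 * \<mu>\<^sup>2))" by simp
      ultimately show "norm ((\<Sum>i<Suc N. T (i + 1)) - 1 / (4 * \<mu>\<^sup>2)) \<le> 3 * (y\<^sup>2 + 2) / \<mu> / (s (Suc N))\<^sup>2"
        unfolding real_norm_def by linarith
    qed
    show "(\<lambda>N. 3 * (y\<^sup>2 + 2) / \<mu> / (s (Suc N))\<^sup>2) \<longlonglongrightarrow> 0"
      by (intro real_tendsto_divide_at_top[OF tendsto_const s2_lim])
  qed
  hence "(\<lambda>N. \<Sum>i<N. T (i + 1)) \<longlonglongrightarrow> 1 / (4 * \<mu>\<^sup>2)"
    by (subst (asm) filterlim_sequentially_Suc)
  thus ?thesis
    by (simp add: sums_def Let_def T_def s_def y_def \<mu>_def)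
qed

end
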